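(* Let $X=X_{d_1,d_2}\subset\mathbb{P}(a_0,\dots,a_5)$ be a quasismooth member of one of the families of Fano 3-folds No. 87, ..., 125 listed in the context. Then $X$ has a linear cyclic quotient singularity. Moreover, at least one of the linear cyclic quotient singularities of $X$ has the highest index among the singularities of $X$.
   Context: All varieties are over $\mathbb{C}$. $\mathbb{P}(a_0,\dots,a_n)$ is the weighted projective space $\operatorname{Proj}\mathbb{C}[x_0,\dots,x_n]$ with $\deg x_i=a_i$; $X_{d_1,d_2}$ denotes a complete intersection of two weighted hypersurfaces of degrees $d_1,d_2$. A subvariety of $\mathbb{P}(a_0,\dots,a_n)$ is quasismooth if its affine cone is smooth outside the origin. A Fano 3-fold is a normal projective 3-fold with $\mathbb{Q}$-factorial terminal singularities and ample $-K_X$. The families (number: $d_1,d_2;\ a_0,\dots,a_5$), all members assumed to be terminal Fano 3-folds, are: 87: 4,4; 1,1,1,2,2,3. 88: 4,6; 1,1,2,2,3,3. 89: 6,6; 1,1,2,2,3,5. 90: 6,8; 1,1,2,3,4,5. 91: 6,6; 1,2,2,3,3,3. 92: 6,8; 1,2,2,3,3,5. 93: 6,10; 1,2,2,3,5,5. 94: 8,10; 1,2,2,3,5,7. 95: 8,10; 1,2,3,4,5,5. 96: 8,12; 1,2,3,4,5,7. 97: 10,14; 1,2,2,5,7,9. 98: 10,12; 1,2,3,4,5,9. 99: 10,12; 1,2,3,5,6,7. 100: 12,14; 1,2,3,4,7,11. 101: 10,12; 2,2,3,5,5,7. 102: 10,14; 2,2,3,5,7,7. 103: 10,12; 2,3,3,4,5,7.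 104: 14,16; 1,2,5,7,8,9. 105: 12,14; 2,2,3,5,7,9. 106: 14,18; 2,2,3,7,9,11. 107: 12,14; 2,3,4,5,7,7. 108: 14,16; 2,3,4,5,7,11. 109: 18,22; 2,2,5,9,11,13. 110: 18,20; 2,4,5,7,9,13. 111: 18,20; 2,5,6,7,9,11. 112: 6,6; 1,1,2,3,3,5. 113: 6,6; 1,2,2,3,3,4. 114: 6,9; 1,2,3,3,4,5. 115: 12,15; 1,3,4,5,6,11. 116: 9,12; 2,3,3,4,5,7. 117: 12,15; 3,3,4,5,7,8. 118: 6,8; 1,2,3,3,4,5. 119: 8,10; 1,2,3,4,5,7. 120: 8,12; 1,3,4,4,5,7. 121: 10,12; 1,3,4,5,6,7. 122: 10,12; 2,3,4,5,5,7. 123: 12,14; 2,3,4,5,7,9. 124: 18,20; 4,5,6,7,9,11. 125: 10,15; 2,3,5,5,7,8. Linear cyclic quotient singularity: write the ambient space as $\operatorname{Proj}\mathbb{C}[x_0,\dots,x_4,\xi]=\mathbb{P}(a_0,\dots,a_4,a_\xi)$ (no specified order on the weights) and let $(f,g)$ be the defining ideal of $X$, of degrees $d_1,d_2$. Suppose that there is a (weighted homogeneous) change of variables after which $f=\xi x_3+f_{d_1}$ and $g=\xi x_4+g_{d_2}$ with $f_{d_1},g_{d_2}\in\mathbb{C}[x_0,\dots,x_4]$. Then the cyclic quotient singularity $\mathbf{p}_\xi=(0:\dots:0:1)\in X$ is said to be linear with respect to $X$. The index of a cyclic quotient singularity $\frac1r(b_1,b_2,b_3)$ is $r$. *)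

theory Defs
  imports "HOL-Analysis.Analysis" "HOL-Library.Poly_Mapping"
begin

section \<open>Polynomials over the complex numbers in variables indexed by a finite type\<close>

type_synonym 'n cpoly = "('n \<Rightarrow>\<^sub>0 nat) \<Rightarrow>\<^sub>0 complex"

definition Var :: "'n \<Rightarrow> 'n cpoly" where
  "Var i = Poly_Mapping.single (Poly_Mapping.single i 1) 1"

definition eval_poly :: "'n::finite cpoly \<Rightarrow> complex ^ 'n \<Rightarrow> complex" where
  "eval_poly f p =
     (\<Sum>m\<in>Poly_Mapping.keys f. Poly_Mapping.lookup f m * (\<Prod>i\<in>UNIV. (p $ i) ^ Poly_Mapping.lookup m i))"

definition subst_poly :: "('n \<Rightarrow> 'n cpoly) \<Rightarrow> 'n::finite cpoly \<Rightarrow> 'n cpoly" where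
  "subst_poly h f =
     (\<Sum>m\<in>Poly_Mapping.keys f.
        Poly_Mapping.single 0 (Poly_Mapping.lookup f m) * (\<Prod>i\<in>UNIV. h i ^ Poly_Mapping.lookup m i))"

text \<open>Formal partial derivative. If the exponent of \<open>i\<close> in \<open>m\<close> is zero, the truncated
  subtraction of exponents is harmless, since the coefficient vanishes.\<close>

definition partial_deriv :: "'n \<Rightarrow> 'n cpoly \<Rightarrow> 'n cpoly" where
  "partial_deriv i f =
     (\<Sum>m\<in>Poly_Mapping.keys f.
        Poly_Mapping.single (m - Poly_Mapping.single i 1)
          (of_nat (Poly_Mapping.lookup m i) * Poly_Mapping.lookup f m))"

definition gradient :: "'n::finite cpoly \<Rightarrow> complex ^ 'n \<Rightarrow> complex ^ 'n" where
  "gradient f p = (\<chi> i. eval_poly (partial_deriv i f) p)"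

definition weighted_degree :: "nat ^ 'n \<Rightarrow> ('n::finite \<Rightarrow>\<^sub>0 nat) \<Rightarrow> nat" where
  "weighted_degree a m = (\<Sum>i\<in>UNIV. a $ i * Poly_Mapping.lookup m i)"

definition weighted_homogeneous :: "nat ^ 'n \<Rightarrow> nat \<Rightarrow> 'n::finite cpoly \<Rightarrow> bool" where
  "weighted_homogeneous a d f \<longleftrightarrow> (\<forall>m\<in>Poly_Mapping.keys f. weighted_degree a m = d)"


section \<open>Complete intersections in weighted projective space\<close>

text \<open>A point of \<open>\<P>(a)\<close> is represented by a nonzero vector, up to the action \<open>weighted_scale a\<close>
  of the nonzero complex numbers. All notions below that concern a point do not depend on the
  representative. The variety \<open>X = (f = g = 0)\<close> is given by its defining ideal \<open>(f, g)\<close>.\<close>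

definition weighted_scale :: "nat ^ 'n \<Rightarrow> complex \<Rightarrow> complex ^ 'n \<Rightarrow> complex ^ 'n" where
  "weighted_scale a l p = (\<chi> i. l ^ (a $ i) * p $ i)"

text \<open>The affine cone of \<open>X\<close> without the origin.\<close>

definition punctured_cone :: "'n::finite cpoly \<Rightarrow> 'n cpoly \<Rightarrow> (complex ^ 'n) set" where
  "punctured_cone f g = {p. p \<noteq> 0 \<and> eval_poly f p = 0 \<and> eval_poly g p = 0}"

text \<open>Complete intersection: \<open>f, g\<close> is a regular sequence.\<close>

definition complete_intersection ::
  "nat ^ 'n \<Rightarrow> nat \<Rightarrow> nat \<Rightarrow> 'n::finite cpoly \<Rightarrow> 'n cpoly \<Rightarrow> bool" where
  "complete_intersection a d1 d2 f g \<longleftrightarrow>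
     weighted_homogeneous a d1 f \<and> weighted_homogeneous a d2 g \<and>
     f \<noteq> 0 \<and> (\<forall>h. f dvd g * h \<longrightarrow> f dvd h)"

text \<open>Smoothness of the cone, which has codimension 2, means that the Jacobian matrix of the two
  generators has rank 2.\<close>

definition quasismooth :: "'n::finite cpoly \<Rightarrow> 'n cpoly \<Rightarrow> bool" where
  "quasismooth f g \<longleftrightarrow>
     (\<forall>p\<in>punctured_cone f g. \<forall>s t.
        s *s gradient f p + t *s gradient g p = 0 \<longrightarrow> s = 0 \<and> t = 0)"


section \<open>Cyclic quotient singularities\<close>

definition stabilizer :: "nat ^ 'n \<Rightarrow> complex ^ 'n \<Rightarrow> complex set" where
  "stabilizer a p = {l. l \<noteq> 0 \<and> weighted_scale a l p = p}"

definition cone_tangent :: "'n::finite cpoly \<Rightarrow> 'n cpoly \<Rightarrow> complex ^ 'n \<Rightarrow> (complex ^ 'n) set" where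
  "cone_tangent f g p =
     {v. (\<Sum>i\<in>UNIV. gradient f p $ i * v $ i) = 0 \<and> (\<Sum>i\<in>UNIV. gradient g p $ i * v $ i) = 0}"

text \<open>The tangent vector at \<open>p\<close> to the orbit of \<open>p\<close>.\<close>

definition orbit_tangent :: "nat ^ 'n \<Rightarrow> complex ^ 'n \<Rightarrow> complex ^ 'n" where
  "orbit_tangent a p = (\<chi> i. of_nat (a $ i) * p $ i)"

text \<open>If the cone is smooth at \<open>p\<close>, then \<open>X\<close> is near \<open>p\<close> the quotient of a slice to the orbit of
  \<open>p\<close> by the stabilizer of \<open>p\<close>, which is the group \<open>\<mu>\<^sub>r\<close> of \<open>r\<close>-th roots of unity. So \<open>X\<close> is
  locally \<open>\<complex>\<^sup>3/\<mu>\<^sub>r\<close> of type \<open>1/r(b1,b2,b3)\<close> if \<open>l \<in> \<mu>\<^sub>r\<close> acts by \<open>l^b1, l^b2, l^b3\<close> on the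
  tangent space of the cone modulo the tangent line of the orbit. The value \<open>r = 1\<close> is allowed
  here. At a coordinate point this is the usual description of the affine chart
  as \<open>\<complex>\<^sup>n/\<mu>\<^sub>r\<close> with the variables as eigenvectors.\<close>

definition local_quotient_type ::
  "nat ^ 'n \<Rightarrow> 'n::finite cpoly \<Rightarrow> 'n cpoly \<Rightarrow> complex ^ 'n \<Rightarrow> nat \<Rightarrow> nat \<Rightarrow> nat \<Rightarrow> nat \<Rightarrow> bool" where
  "local_quotient_type a f g p r b1 b2 b3 \<longleftrightarrow>
     p \<in> punctured_cone f g \<and> finite (stabilizer a p) \<and> card (stabilizer a p) = r \<and>
     (\<exists>v1 v2 v3.
        distinct [orbit_tangent a p, v1, v2, v3] \<and>
        vec.independent {orbit_tangent a p, v1, v2, v3} \<and>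
        vec.span {orbit_tangent a p, v1, v2, v3} = cone_tangent f g p \<and>
        (\<forall>l\<in>stabilizer a p.
           weighted_scale a l v1 = l ^ b1 *s v1 \<and>
           weighted_scale a l v2 = l ^ b2 *s v2 \<and>
           weighted_scale a l v3 = l ^ b3 *s v3))"

text \<open>The coprimality conditions say that \<open>\<mu>\<^sub>r\<close> contains no quasi-reflections, so that the
  quotient is really singular for \<open>r \<ge> 2\<close> and \<open>r\<close>, the index, is an invariant of the singularity.\<close>

definition cyclic_quotient_singularity ::
  "nat ^ 'n \<Rightarrow> 'n::finite cpoly \<Rightarrow> 'n cpoly \<Rightarrow> complex ^ 'n \<Rightarrow> nat \<Rightarrow> nat \<Rightarrow> nat \<Rightarrow> nat \<Rightarrow> bool" where
  "cyclic_quotient_singularity a f g p r b1 b2 b3 \<longleftrightarrow>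
     r \<ge> 2 \<and> local_quotient_type a f g p r b1 b2 b3 \<and>
     coprime r (gcd b1 b2) \<and> coprime r (gcd b1 b3) \<and> coprime r (gcd b2 b3)"

text \<open>Terminal Fano 3-folds among quasismooth \<open>X\<close>. As \<open>X\<close> has only quotient singularities, it is
  normal and \<open>\<rat>\<close>-factorial. By adjunction \<open>-K\<^sub>X\<close> is \<open>\<O>(a\<^sub>0 + \<dots> + a\<^sub>5 - d1 - d2)\<close>. By the
  Reid-Tai criterion \<open>1/r(b1,b2,b3)\<close> is terminal iff every nontrivial element of \<open>\<mu>\<^sub>r\<close> has age
  greater than 1 (which also excludes quasi-reflections).\<close>

definition terminal_Fano ::
  "nat ^ 'n \<Rightarrow> nat \<Rightarrow> nat \<Rightarrow> 'n::finite cpoly \<Rightarrow> 'n cpoly \<Rightarrow> bool" where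
  "terminal_Fano a d1 d2 f g \<longleftrightarrow>
     d1 + d2 < (\<Sum>i\<in>UNIV. a $ i) \<and>
     (\<forall>p r b1 b2 b3. local_quotient_type a f g p r b1 b2 b3 \<longrightarrow>
        (\<forall>k\<in>{1..<r}. frac (real (k * b1) / real r) + frac (real (k * b2) / real r)
                        + frac (real (k * b3) / real r) > 1))"


section \<open>Linear cyclic quotient singularities\<close>

text \<open>A weighted homogeneous change of variables: the old variable \<open>i\<close> is replaced by the
  polynomial \<open>h i\<close> in the new variables, and \<open>k\<close> is the inverse substitution.\<close>

definition change_of_variables :: "nat ^ 'n \<Rightarrow> ('n::finite \<Rightarrow> 'n cpoly) \<Rightarrow> bool" where
  "change_of_variables a h \<longleftrightarrow>
     (\<forall>i. weighted_homogeneous a (a $ i) (h i)) \<and>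
     (\<exists>k. (\<forall>i. weighted_homogeneous a (a $ i) (k i)) \<and>
          (\<forall>i. subst_poly h (k i) = Var i \<and> subst_poly k (h i) = Var i))"

definition free_of_var :: "'n \<Rightarrow> 'n cpoly \<Rightarrow> bool" where
  "free_of_var i f \<longleftrightarrow> (\<forall>m\<in>Poly_Mapping.keys f. Poly_Mapping.lookup m i = 0)"

text \<open>The index \<open>x\<close> plays the role of \<open>\<xi>\<close>, and \<open>i\<close>, \<open>j\<close> those of \<open>3\<close>, \<open>4\<close>. In the new
  variables \<open>p\<close> is the coordinate point of \<open>x\<close>: as the vectors \<open>axis x c\<close> with \<open>c \<noteq> 0\<close> are the
  representatives of that point, \<open>p\<close> is the image of one of them.\<close>

definition linear_singularity ::
  "nat ^ 'n \<Rightarrow> nat \<Rightarrow> nat \<Rightarrow> 'n::finite cpoly \<Rightarrow> 'n cpoly \<Rightarrow> complex ^ 'n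
     \<Rightarrow> nat \<Rightarrow> nat \<Rightarrow> nat \<Rightarrow> nat \<Rightarrow> bool" where
  "linear_singularity a d1 d2 f g p r b1 b2 b3 \<longleftrightarrow>
     cyclic_quotient_singularity a f g p r b1 b2 b3 \<and>
     (\<exists>h x i j f' g'.
        change_of_variables a h \<and> distinct [x, i, j] \<and>
        (\<exists>c. c \<noteq> 0 \<and> p = (\<chi> l. eval_poly (h l) (axis x c))) \<and>
        weighted_homogeneous a d1 f' \<and> free_of_var x f' \<and>
        weighted_homogeneous a d2 g' \<and> free_of_var x g' \<and>
        subst_poly h f = Var x * Var i + f' \<and>
        subst_poly h g = Var x * Var j + g')"


section \<open>The families\<close>

text \<open>Entries are \<open>(number, d1, d2, weights)\<close>.\<close>

definition Fano_families :: "(nat \<times> nat \<times> nat \<times> nat list) set" where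
  "Fano_families = {
   (87, 4, 4, [1, 1, 1, 2, 2, 3]),
   (88, 4, 6, [1, 1, 2, 2, 3, 3]),
   (89, 6, 6, [1, 1, 2, 2, 3, 5]),
   (90, 6, 8, [1, 1, 2, 3, 4, 5]),
   (91, 6, 6, [1, 2, 2, 3, 3, 3]),
   (92, 6, 8, [1, 2, 2, 3, 3, 5]),
   (93, 6, 10, [1, 2, 2, 3, 5, 5]),
   (94, 8, 10, [1, 2, 2, 3, 5, 7]),
   (95, 8, 10, [1, 2, 3, 4, 5, 5]),
   (96, 8, 12, [1, 2, 3, 4, 5, 7]),
   (97, 10, 14, [1, 2, 2, 5, 7, 9]),
   (98, 10, 12, [1, 2, 3, 4, 5, 9]),
   (99, 10, 12, [1, 2, 3, 5, 6, 7]),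
   (100, 12, 14, [1, 2, 3, 4, 7, 11]),
   (101, 10, 12, [2, 2, 3, 5, 5, 7]),
   (102, 10, 14, [2, 2, 3, 5, 7, 7]),
   (103, 10, 12, [2, 3, 3, 4, 5, 7]),
   (104, 14, 16, [1, 2, 5, 7, 8, 9]),
   (105, 12, 14, [2, 2, 3, 5, 7, 9]),
   (106, 14, 18, [2, 2, 3, 7, 9, 11]),
   (107, 12, 14, [2, 3, 4, 5, 7, 7]),
   (108, 14, 16, [2, 3, 4, 5, 7, 11]),
   (109, 18, 22, [2, 2, 5, 9, 11, 13]),
   (110, 18, 20, [2, 4, 5, 7, 9, 13]),
   (111, 18, 20, [2, 5, 6, 7, 9, 11]),
   (112, 6, 6, [1, 1, 2, 3, 3, 5]),
   (113, 6, 6, [1, 2, 2, 3, 3, 4]),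
   (114, 6, 9, [1, 2, 3, 3, 4, 5]),
   (115, 12, 15, [1, 3, 4, 5, 6, 11]),
   (116, 9, 12, [2, 3, 3, 4, 5, 7]),
   (117, 12, 15, [3, 3, 4, 5, 7, 8]),
   (118, 6, 8, [1, 2, 3, 3, 4, 5]),
   (119, 8, 10, [1, 2, 3, 4, 5, 7]),
   (120, 8, 12, [1, 3, 4, 4, 5, 7]),
   (121, 10, 12, [1, 3, 4, 5, 6, 7]),
   (122, 10, 12, [2, 3, 4, 5, 5, 7]),
   (123, 12, 14, [2, 3, 4, 5, 7, 9]),
   (124, 18, 20, [4, 5, 6, 7, 9, 11]),
   (125, 10, 15, [2, 3, 5, 5, 7, 8])}"

end

theory Submission
  imports Defs "HOL-Computational_Algebra.Fundamental_Theorem_Algebra"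
begin

text \<open>
  Let \<open>M\<close> be the largest weight. The index of a quotient singularity of \<open>X\<close> never exceeds \<open>M\<close>, since
  the stabilizer of a point consists of roots of unity of order dividing the weight of a nonvanishing
  coordinate (\<open>index_le_weight\<close>). So it is enough to find one linear singularity, of index \<open>M\<close>.

  All families share the numerical property that \<open>M < d1 \<le> 2 * M\<close> and \<open>M < d2 \<le> 2 * M\<close>, and that there are
  more variables of weight \<open>M\<close> than equations of degree \<open>2 * M\<close> (\<open>Fano_families_weights\<close>). On the space
  spanned by the variables of weight \<open>M\<close> an equation of degree \<open>2 * M\<close> is a quadratic form, and one of a
  smaller degree vanishes. Hence \<open>X\<close> contains a point \<open>p\<close> all of whose nonzero coordinates have weight
  \<open>M\<close> (\<open>point_of_maximal_weight\<close>); for the weights 1,2,2,3,3,3 this needs a common point of two plane conics, and in the other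
  cases a zero of a binary quadratic form or a coordinate point suffices.

  A linear change of variables turns \<open>p\<close> into the coordinate point of a variable \<open>\<xi>\<close> of weight \<open>M\<close>. For
  reasons of degree, and because \<open>p\<close> lies on \<open>X\<close>, the equations become \<open>\<xi> A + f'\<close> and \<open>\<xi> B + g'\<close> without \<open>\<xi>\<close>
  in \<open>A\<close>, \<open>B\<close>, \<open>f'\<close>, \<open>g'\<close>. As \<open>d1\<close> and \<open>d2\<close> exceed all weights, \<open>f'\<close> and \<open>g'\<close> have no linear terms, so the
  gradients at \<open>p\<close> are the linear parts of \<open>A\<close> and \<open>B\<close>. By quasismoothness they are independent, and \<open>A\<close>
  and \<open>B\<close> can be taken as new coordinates (\<open>linear_normal_form\<close>).

  In this normal form the tangent space at \<open>p\<close> is a coordinate subspace, and the stabilizer \<open>\<mu>\<^sub>M\<close> acts on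
  it with the weights of the remaining variables. Since changes of variables commute with the weighted
  action, their Jacobian matrices carry this description back to the original coordinates
  (\<open>linear_form_local_quotient_type\<close>). Terminality excludes quasi-reflections
  (\<open>terminal_Fano_cyclic_quotient_singularity\<close>), so \<open>p\<close> is a cyclic quotient singularity of index \<open>M\<close>.
\<close>

section \<open>Evaluation and substitution\<close>

abbreviation scalar :: "complex \<Rightarrow> 'n cpoly" where
  "scalar \<equiv> Poly_Mapping.single 0"

lemma cpoly_induct_keys [consumes 0, case_names zero monomial add]:
  fixes f :: "'n cpoly"
  assumes zero: "P 0"
    and monomial: "\<And>m c. m \<in> Poly_Mapping.keys f \<Longrightarrow> P (Poly_Mapping.single m c)"
    and add: "\<And>f g. P f \<Longrightarrow> P g \<Longrightarrow> P (f + g)"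
  shows "P f"
proof -
  have "P (\<Sum>m\<in>A. Poly_Mapping.single m (Poly_Mapping.lookup f m))"
    if "finite A" "A \<subseteq> Poly_Mapping.keys f" for A
    using that by induction (auto simp: zero monomial add)
  moreover have "(\<Sum>m\<in>Poly_Mapping.keys f. Poly_Mapping.single m (Poly_Mapping.lookup f m)) = f"
    by (rule poly_mapping_eqI)
      (auto simp: lookup_sum lookup_single when_def sum.delta in_keys_iff)
  ultimately show ?thesis
    by (metis finite_keys order_refl)
qed

lemma cpoly_induct_monomial:
  assumes "\<And>m c. P (Poly_Mapping.single m c)" and "\<And>f g. P f \<Longrightarrow> P g \<Longrightarrow> P (f + g)"
  shows "P (f :: 'n cpoly)"
  by (rule cpoly_induct_keys) (use assms assms(1)[of 0 0] in \<open>simp_all only: single_zero\<close>)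

lemma prod_single_one:
  "finite A \<Longrightarrow> (\<Prod>i\<in>A. Poly_Mapping.single (e i) (1::complex)) = Poly_Mapping.single (\<Sum>i\<in>A. e i) 1"
  by (induction rule: finite_induct) (auto simp: mult_single)

lemma Var_power: "Var i ^ k = Poly_Mapping.single (Poly_Mapping.single i k) 1"
  by (induction k) (auto simp: Var_def mult_single simp flip: single_add)

lemma monomial_eq_prod_Var:
  fixes m :: "'n::finite \<Rightarrow>\<^sub>0 nat"
  shows "Poly_Mapping.single m c = scalar c * (\<Prod>i\<in>UNIV. Var i ^ Poly_Mapping.lookup m i)"
proof -
  have "(\<Sum>i\<in>UNIV. Poly_Mapping.single i (Poly_Mapping.lookup m i)) = m"
    by (rule poly_mapping_eqI) (auto simp: lookup_sum lookup_single when_def)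
  then show ?thesis
    by (simp add: Var_power prod_single_one mult_single)
qed

text \<open>Both evaluation and substitution respect sums and products, so identities between them need to be
  checked only on scalars and variables.\<close>

lemma cpoly_induct [case_names scalar Var add mult]:
  fixes f :: "'n::finite cpoly"
  assumes "\<And>c. P (scalar c)" "\<And>i. P (Var i)"
    and "\<And>f g. P f \<Longrightarrow> P g \<Longrightarrow> P (f + g)" and mult: "\<And>f g. P f \<Longrightarrow> P g \<Longrightarrow> P (f * g)"
  shows "P f"
proof (induction f rule: cpoly_induct_monomial)
  case (1 m c)
  have pw: "P (Var i ^ k)" for i k
    using assms(1)[of 1] assms(2) mult by (induction k) auto
  have "P (\<Prod>i\<in>A. Var i ^ Poly_Mapping.lookup m i)" if "finite A" for A
    using that assms(1)[of 1] pw mult by induction auto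
  then show ?case
    unfolding monomial_eq_prod_Var[of m c] by (intro mult assms(1)) auto
qed (use assms in blast)

text \<open>Evaluation at a point and substitution of polynomials are the same construction: the homomorphism
  from the polynomial ring that extends a map \<open>\<phi>\<close> of the coefficients and sends the variables to \<open>v\<close>.
  For points \<open>\<phi>\<close> is the identity of \<open>\<complex>\<close>, for substitutions it is the inclusion of the scalars.\<close>

definition evaluate :: "(complex \<Rightarrow> 'r::comm_ring_1) \<Rightarrow> ('n \<Rightarrow> 'r) \<Rightarrow> 'n::finite cpoly \<Rightarrow> 'r" where
  "evaluate \<phi> v f =
     (\<Sum>m\<in>Poly_Mapping.keys f. \<phi> (Poly_Mapping.lookup f m) * (\<Prod>i\<in>UNIV. v i ^ Poly_Mapping.lookup m i))"

definition coefficient_hom :: "(complex \<Rightarrow> 'r::comm_ring_1) \<Rightarrow> bool" where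
  "coefficient_hom \<phi> \<longleftrightarrow>
     \<phi> 1 = 1 \<and> (\<forall>a b. \<phi> (a + b) = \<phi> a + \<phi> b) \<and> (\<forall>a b. \<phi> (a * b) = \<phi> a * \<phi> b)"

context
  fixes \<phi> :: "complex \<Rightarrow> 'r::comm_ring_1"
  assumes \<phi>: "coefficient_hom \<phi>"
begin

lemma coefficient_hom_zero: "\<phi> 0 = 0"
  using \<phi> unfolding coefficient_hom_def by (metis add_cancel_right_right)

lemma evaluate_monomial:
  "evaluate \<phi> v (Poly_Mapping.single m c) = \<phi> c * (\<Prod>i\<in>UNIV. v i ^ Poly_Mapping.lookup m i)"
  by (simp add: evaluate_def coefficient_hom_zero)

lemma evaluate_add: "evaluate \<phi> v (f + g) = evaluate \<phi> v f + evaluate \<phi> v g"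
  unfolding evaluate_def
  by (rule setsum_keys_plus_distrib[where f = "\<lambda>m c. \<phi> c * (\<Prod>i\<in>UNIV. v i ^ Poly_Mapping.lookup m i)"])
    (use \<phi> in \<open>auto simp: coefficient_hom_zero coefficient_hom_def algebra_simps\<close>)

lemma evaluate_mult: "evaluate \<phi> v (f * g) = evaluate \<phi> v f * evaluate \<phi> v g"
proof (induction f rule: cpoly_induct_monomial)
  case (1 m c)
  show ?case
  proof (induction g rule: cpoly_induct_monomial)
    case (1 n d)
    then show ?case
      using \<phi> by (simp add: mult_single evaluate_monomial lookup_add power_add prod.distrib
          coefficient_hom_def algebra_simps)
  qed (simp add: distrib_left evaluate_add)
qed (simp add: distrib_right evaluate_add)

end

lemma coefficient_hom_id: "coefficient_hom (\<lambda>c. c)"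
  by (simp add: coefficient_hom_def)

lemma coefficient_hom_scalar: "coefficient_hom scalar"
  by (simp add: coefficient_hom_def single_add mult_single)

lemma eval_poly_eq_evaluate: "eval_poly f p = evaluate (\<lambda>c. c) (($) p) f"
  by (simp add: eval_poly_def evaluate_def)

lemma subst_poly_eq_evaluate: "subst_poly h f = evaluate scalar h f"
  by (simp add: subst_poly_def evaluate_def)

lemma eval_poly_add [simp]: "eval_poly (f + g) p = eval_poly f p + eval_poly g p"
  by (simp add: eval_poly_eq_evaluate evaluate_add coefficient_hom_id)

lemma eval_poly_mult [simp]: "eval_poly (f * g) p = eval_poly f p * eval_poly g p"
  by (simp add: eval_poly_eq_evaluate evaluate_mult coefficient_hom_id)

lemma eval_poly_monomial:
  "eval_poly (Poly_Mapping.single m c) p = c * (\<Prod>i\<in>UNIV. (p $ i) ^ Poly_Mapping.lookup m i)"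
  by (simp add: eval_poly_eq_evaluate evaluate_monomial coefficient_hom_id)

lemma eval_poly_scalar [simp]: "eval_poly (scalar c) p = c"
  by (simp add: eval_poly_monomial)

lemma prod_power_single:
  fixes v :: "'n::finite \<Rightarrow> 'r::comm_ring_1"
  shows "(\<Prod>j\<in>UNIV. v j ^ Poly_Mapping.lookup (Poly_Mapping.single i k) j) = v i ^ k"
proof -
  have "(\<Prod>j\<in>UNIV. v j ^ Poly_Mapping.lookup (Poly_Mapping.single i k) j) = (\<Prod>j\<in>UNIV. if j = i then v j ^ k else 1)"
    by (intro prod.cong) (auto simp: lookup_single when_def)
  then show ?thesis by simp
qed

lemma eval_poly_Var [simp]: "eval_poly (Var i) p = p $ i"
  by (simp add: Var_def eval_poly_monomial prod_power_single)

lemma subst_poly_add [simp]: "subst_poly h (f + g) = subst_poly h f + subst_poly h g"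
  by (simp add: subst_poly_eq_evaluate evaluate_add coefficient_hom_scalar)

lemma subst_poly_mult [simp]: "subst_poly h (f * g) = subst_poly h f * subst_poly h g"
  by (simp add: subst_poly_eq_evaluate evaluate_mult coefficient_hom_scalar)

lemma subst_poly_monomial:
  "subst_poly h (Poly_Mapping.single m c) = scalar c * (\<Prod>i\<in>UNIV. h i ^ Poly_Mapping.lookup m i)"
  by (simp add: subst_poly_eq_evaluate evaluate_monomial coefficient_hom_scalar)

lemma subst_poly_scalar [simp]: "subst_poly h (scalar c) = scalar c"
  by (simp add: subst_poly_monomial)

lemma subst_poly_Var [simp]: "subst_poly h (Var i) = h i"
  by (simp add: Var_def subst_poly_monomial prod_power_single)

lemma subst_poly_zero [simp]: "subst_poly h 0 = 0"
  by (simp add: subst_poly_def)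

lemma subst_poly_uminus [simp]: "subst_poly h (- f) = - subst_poly h f"
  by (metis add_eq_0_iff2 single_zero subst_poly_add subst_poly_scalar add.right_inverse)

lemma subst_poly_diff [simp]: "subst_poly h (f - g) = subst_poly h f - subst_poly h g"
  by (metis add_uminus_conv_diff subst_poly_add subst_poly_uminus)

lemma subst_poly_subst_poly:
  "subst_poly h (subst_poly k f) = subst_poly (\<lambda>i. subst_poly h (k i)) f"
  by (induction f rule: cpoly_induct) auto

lemma subst_poly_Var_id: "subst_poly Var f = f"
  by (induction f rule: cpoly_induct) auto

text \<open>The polynomial map of affine space that belongs to the substitution \<open>h\<close>. Substituting
  \<open>h\<close> into a polynomial composes its function with this map.\<close>

definition subst_point :: "('n::finite \<Rightarrow> 'n cpoly) \<Rightarrow> complex ^ 'n \<Rightarrow> complex ^ 'n" where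
  "subst_point h p = (\<chi> i. eval_poly (h i) p)"

lemma eval_subst_poly: "eval_poly (subst_poly h f) p = eval_poly f (subst_point h p)"
  by (induction f rule: cpoly_induct) (auto simp: subst_point_def)

lemma subst_point_compose:
  "subst_point (\<lambda>i. subst_poly h (k i)) p = subst_point k (subst_point h p)"
  unfolding subst_point_def[of k] subst_point_def[of "\<lambda>i. subst_poly h (k i)"]
  by (simp add: eval_subst_poly)

lemma subst_point_Var: "subst_point Var p = p"
  by (simp add: subst_point_def vec_eq_iff)

section \<open>Derivatives\<close>

lemma partial_deriv_add: "partial_deriv i (f + g) = partial_deriv i f + partial_deriv i g"
  unfolding partial_deriv_def
  by (rule setsum_keys_plus_distrib[where f = "\<lambda>m c. Poly_Mapping.single (m - Poly_Mapping.single i 1)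
          (of_nat (Poly_Mapping.lookup m i) * c)"]) (auto simp: algebra_simps single_add)

lemma partial_deriv_monomial:
  "partial_deriv i (Poly_Mapping.single m c) =
     Poly_Mapping.single (m - Poly_Mapping.single i 1) (of_nat (Poly_Mapping.lookup m i) * c)"
  by (simp add: partial_deriv_def)

lemma partial_deriv_scalar: "partial_deriv i (scalar c) = 0"
  by (simp add: partial_deriv_monomial)

lemma partial_deriv_Var: "partial_deriv i (Var j) = (if i = j then 1 else 0)"
  by (simp add: Var_def partial_deriv_monomial lookup_single)

lemma single_diff_one_add:
  assumes "0 < Poly_Mapping.lookup m i"
  shows "m + n - Poly_Mapping.single i (1::nat) = (m - Poly_Mapping.single i 1) + n"
  using assms by (intro poly_mapping_eqI) (auto simp: lookup_add lookup_minus lookup_single when_def)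

lemma partial_deriv_mult:
  "partial_deriv i (f * g) = partial_deriv i f * g + f * partial_deriv i g"
proof (induction f rule: cpoly_induct_monomial)
  case (1 m c)
  show ?case
  proof (induction g rule: cpoly_induct_monomial)
    case (1 n d)
    let ?e = "Poly_Mapping.single i (1::nat)"
    let ?m = "Poly_Mapping.lookup m i" and ?n = "Poly_Mapping.lookup n i"
    have "Poly_Mapping.single (m + n - ?e) (of_nat ?m * c * d) = Poly_Mapping.single (m - ?e + n) (of_nat ?m * c * d)"
      using single_diff_one_add[of m i n] by (cases "?m = 0") auto
    moreover have "Poly_Mapping.single (m + n - ?e) (of_nat ?n * c * d) = Poly_Mapping.single (m + (n - ?e)) (of_nat ?n * c * d)"
      using single_diff_one_add[of n i m] by (cases "?n = 0") (auto simp: add.commute)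
    moreover have "Poly_Mapping.single (m + n - ?e) (of_nat (?m + ?n) * (c * d)) =
      Poly_Mapping.single (m + n - ?e) (of_nat ?m * c * d) + Poly_Mapping.single (m + n - ?e) (of_nat ?n * c * d)"
      by (simp add: algebra_simps flip: single_add)
    ultimately show ?case
      by (simp add: mult_single partial_deriv_monomial lookup_add algebra_simps)
  qed (simp add: distrib_left partial_deriv_add)
qed (simp add: distrib_right partial_deriv_add)

lemma gradient_add: "gradient (f + g) p = gradient f p + gradient g p"
  by (simp add: gradient_def vec_eq_iff partial_deriv_add)

lemma gradient_mult: "gradient (f * g) p = eval_poly g p *s gradient f p + eval_poly f p *s gradient g p"
  by (simp add: gradient_def vec_eq_iff partial_deriv_mult)

lemma eval_poly_zero [simp]: "eval_poly 0 p = 0"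
  using eval_poly_scalar[of 0 p] by simp

lemma eval_poly_one [simp]: "eval_poly 1 p = 1"
  using eval_poly_scalar[of 1 p] by (simp del: eval_poly_scalar)

lemma gradient_scalar: "gradient (scalar c) p = 0"
  by (simp add: gradient_def vec_eq_iff partial_deriv_scalar)

lemma gradient_Var: "gradient (Var i) p = axis i 1"
  by (simp add: gradient_def vec_eq_iff partial_deriv_Var axis_def)

lemma chain_rule:
  "gradient (subst_poly h f) p = (\<Sum>l\<in>UNIV. gradient f (subst_point h p) $ l *s gradient (h l) p)"
proof (induction f rule: cpoly_induct)
  case (Var i)
  then show ?case
    by (simp add: gradient_Var axis_def if_distrib[where f="\<lambda>c. c *s _"] cong: if_cong)
next
  case (add f g)
  then show ?case
    by (simp add: gradient_add vec.scale_left_distrib sum.distrib)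
next
  case (mult f g)
  then show ?case
    by (simp add: gradient_mult eval_subst_poly vec.scale_left_distrib sum.distrib vec.scale_sum_right vec.scale_scale)
qed (simp add: gradient_scalar)

section \<open>Weighted homogeneous polynomials\<close>

lemma weighted_degree_add: "weighted_degree a (m + n) = weighted_degree a m + weighted_degree a n"
  by (simp add: weighted_degree_def lookup_add distrib_left sum.distrib)

lemma weighted_degree_single [simp]: "weighted_degree a (Poly_Mapping.single i k) = a $ i * k"
proof -
  have "weighted_degree a (Poly_Mapping.single i k) = (\<Sum>j\<in>UNIV. if j = i then a $ j * k else 0)"
    unfolding weighted_degree_def by (rule sum.cong) (simp_all add: lookup_single when_def)
  also have "\<dots> = a $ i * k"
    by (simp only: sum.delta[OF finite_class.finite_UNIV] UNIV_I if_True)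
  finally show ?thesis .
qed

lemma weighted_homogeneous_zero [simp]: "weighted_homogeneous a d 0"
  by (simp add: weighted_homogeneous_def)

lemma weighted_homogeneous_monomial:
  "weighted_degree a m = d \<Longrightarrow> weighted_homogeneous a d (Poly_Mapping.single m c)"
  by (simp add: weighted_homogeneous_def)

lemma weighted_homogeneous_scalar: "weighted_homogeneous a 0 (scalar c)"
  by (simp add: weighted_homogeneous_def weighted_degree_def)

lemma weighted_homogeneous_Var: "weighted_homogeneous a (a $ i) (Var i)"
  by (simp add: weighted_homogeneous_def Var_def)

lemma weighted_homogeneous_add:
  "weighted_homogeneous a d f \<Longrightarrow> weighted_homogeneous a d g \<Longrightarrow> weighted_homogeneous a d (f + g)"
  using keys_add[of f g] by (auto simp: weighted_homogeneous_def)

lemma weighted_homogeneous_mult: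
  "weighted_homogeneous a d f \<Longrightarrow> weighted_homogeneous a e g \<Longrightarrow> weighted_homogeneous a (d + e) (f * g)"
  using keys_mult[of f g] unfolding weighted_homogeneous_def
  by (smt (verit) mem_Collect_eq subsetD weighted_degree_add)

lemma weighted_homogeneous_scale:
  "weighted_homogeneous a d f \<Longrightarrow> weighted_homogeneous a d (scalar c * f)"
  using weighted_homogeneous_mult[OF weighted_homogeneous_scalar, of a d f c] by simp

lemma weighted_homogeneous_diff:
  "weighted_homogeneous a d f \<Longrightarrow> weighted_homogeneous a d g \<Longrightarrow> weighted_homogeneous a d (f - g)"
  using keys_diff[of f g] by (auto simp: weighted_homogeneous_def)

lemma weighted_homogeneous_power:
  "weighted_homogeneous a d f \<Longrightarrow> weighted_homogeneous a (d * k) (f ^ k)"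
proof (induction k)
  case (Suc k)
  then show ?case
    using weighted_homogeneous_mult[of a d f "d * k" "f ^ k"] by simp
qed (use weighted_homogeneous_scalar[of a 1] in simp)

lemma weighted_homogeneous_prod:
  "finite I \<Longrightarrow> (\<And>i. weighted_homogeneous a (d i) (f i)) \<Longrightarrow>
     weighted_homogeneous a (\<Sum>i\<in>I. d i) (\<Prod>i\<in>I. f i)"
proof (induction rule: finite_induct)
  case empty
  then show ?case
    using weighted_homogeneous_scalar[of a 1] by simp
qed (simp add: weighted_homogeneous_mult)

lemma weighted_homogeneous_subst_poly:
  assumes h: "\<And>i. weighted_homogeneous a (a $ i) (h i)" and f: "weighted_homogeneous a d f"
  shows "weighted_homogeneous a d (subst_poly h f)"
proof (induction f rule: cpoly_induct_keys)
  case (monomial m c)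
  then have d: "(\<Sum>i\<in>UNIV. a $ i * Poly_Mapping.lookup m i) = d"
    using f by (auto simp: weighted_homogeneous_def weighted_degree_def)
  have "weighted_homogeneous a d (\<Prod>i\<in>UNIV. h i ^ Poly_Mapping.lookup m i)"
    unfolding d[symmetric] by (intro weighted_homogeneous_prod weighted_homogeneous_power h) auto
  then show ?case
    by (simp add: subst_poly_monomial weighted_homogeneous_scale)
qed (simp_all add: weighted_homogeneous_add)

text \<open>Weighted homogeneity as an identity of polynomials. Evaluating it gives the scaling law of values,
  and differentiating it gives the one of gradients, in which the exponent drops by the weight of the
  variable.\<close>

lemma subst_poly_weighted_scale:
  fixes f :: "'n::finite cpoly"
  assumes f: "weighted_homogeneous a d f"
  shows "subst_poly (\<lambda>i. scalar (l ^ (a $ i)) * Var i) f = scalar (l ^ d) * f"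
proof (induction f rule: cpoly_induct_keys)
  case (monomial m c)
  then have d: "(\<Sum>i\<in>UNIV. a $ i * Poly_Mapping.lookup m i) = d"
    using f by (auto simp: weighted_homogeneous_def weighted_degree_def)
  have pw: "scalar y ^ k = (scalar (y ^ k) :: 'n cpoly)" for y :: complex and k
    by (induction k) (auto simp: mult_single)
  have prod_scalar: "(\<Prod>i\<in>A. scalar (y i)) = (scalar (\<Prod>i\<in>A. y i) :: 'n cpoly)" for A and y :: "'a \<Rightarrow> complex"
    by (induction A rule: infinite_finite_induct) (auto simp: mult_single)
  have "(\<Prod>i\<in>UNIV. scalar (l ^ (a $ i)) ^ Poly_Mapping.lookup m i) = (scalar (l ^ d) :: 'n cpoly)"
    unfolding d[symmetric] pw power_sum power_mult prod_scalar ..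
  then have "subst_poly (\<lambda>i. scalar (l ^ (a $ i)) * Var i) (Poly_Mapping.single m c) =
      scalar (l ^ d) * (scalar c * (\<Prod>i\<in>UNIV. Var i ^ Poly_Mapping.lookup m i))"
    by (simp only: subst_poly_monomial power_mult_distrib prod.distrib mult.left_commute)
  then show ?case
    by (simp only: monomial_eq_prod_Var[of m c])
qed (simp_all only: subst_poly_zero subst_poly_add distrib_left mult_zero_right)
lemma subst_point_scaled_Var:
  "subst_point (\<lambda>i. scalar (l ^ (a $ i)) * Var i) p = weighted_scale a l p"
  by (simp add: subst_point_def weighted_scale_def vec_eq_iff)

lemma eval_poly_weighted_scale:
  "weighted_homogeneous a d f \<Longrightarrow> eval_poly f (weighted_scale a l p) = l ^ d * eval_poly f p"
  using eval_subst_poly[of "\<lambda>i. scalar (l ^ (a $ i)) * Var i" f p]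
  by (simp add: subst_poly_weighted_scale subst_point_scaled_Var)

lemma gradient_weighted_scale:
  assumes "weighted_homogeneous a d f"
  shows "gradient f (weighted_scale a l p) $ k * l ^ (a $ k) = l ^ d * gradient f p $ k"
proof -
  have "l ^ d *s gradient f p = (\<Sum>j\<in>UNIV. gradient f (weighted_scale a l p) $ j *s (l ^ (a $ j) *s axis j 1))"
    using chain_rule[of "\<lambda>i. scalar (l ^ (a $ i)) * Var i" f p]
    by (simp add: subst_poly_weighted_scale[OF assms] subst_point_scaled_Var gradient_mult gradient_scalar gradient_Var)
  then have "(l ^ d *s gradient f p) $ k = (\<Sum>j\<in>UNIV. gradient f (weighted_scale a l p) $ j * (l ^ (a $ j) * axis j 1 $ k))"
    by (simp only: sum_component vector_smult_component)
  then show ?thesis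
    by (simp add: axis_def if_distrib[where f = "\<lambda>c. _ * c"] cong: if_cong)
qed

lemma gradient_zero [simp]: "gradient 0 p = 0"
  using gradient_scalar[of 0 p] by simp

lemma gradient_monomial:
  "gradient (Poly_Mapping.single m c) p $ k =
     of_nat (Poly_Mapping.lookup m k) * c *
       (\<Prod>i\<in>UNIV. (p $ i) ^ Poly_Mapping.lookup (m - Poly_Mapping.single k 1) i)"
  by (simp add: gradient_def partial_deriv_monomial eval_poly_monomial)

lemma single_add_diff_single:
  "Poly_Mapping.lookup m k \<noteq> 0 \<Longrightarrow> m = Poly_Mapping.single k (1::nat) + (m - Poly_Mapping.single k 1)"
  by (intro poly_mapping_eqI) (auto simp: lookup_add lookup_minus lookup_single when_def)

text \<open>Monomial by monomial: \<open>x\<^sub>k \<partial>\<^sub>k\<close> multiplies a monomial by its exponent at \<open>k\<close>, and the weighted sum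
  of the exponents is the degree.\<close>

lemma Euler_identity:
  assumes f: "weighted_homogeneous a d f"
  shows "(\<Sum>k\<in>UNIV. of_nat (a $ k) * p $ k * gradient f p $ k) = of_nat d * eval_poly f p"
proof (induction f rule: cpoly_induct_keys)
  case (monomial m c)
  then have d: "(\<Sum>i\<in>UNIV. a $ i * Poly_Mapping.lookup m i) = d"
    using f by (auto simp: weighted_homogeneous_def weighted_degree_def)
  have "p $ k * gradient (Poly_Mapping.single m c) p $ k =
      of_nat (Poly_Mapping.lookup m k) * eval_poly (Poly_Mapping.single m c) p" for k
  proof (cases "Poly_Mapping.lookup m k = 0")
    case False
    let ?e = "Poly_Mapping.single k (1::nat)"
    have "m = ?e + (m - ?e)"
      using False by (rule single_add_diff_single)
    then have "Poly_Mapping.lookup m i = Poly_Mapping.lookup ?e i + Poly_Mapping.lookup (m - ?e) i" for i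
      by (metis lookup_add)
    then have "(\<Prod>i\<in>UNIV. (p $ i) ^ Poly_Mapping.lookup m i) =
        p $ k * (\<Prod>i\<in>UNIV. (p $ i) ^ Poly_Mapping.lookup (m - ?e) i)"
      by (simp only: power_add prod.distrib prod_power_single power_one_right)
    then show ?thesis
      by (simp add: gradient_monomial eval_poly_monomial)
  qed (simp add: gradient_monomial)
  then have "(\<Sum>k\<in>UNIV. of_nat (a $ k) * p $ k * gradient (Poly_Mapping.single m c) p $ k) =
      (\<Sum>k\<in>UNIV. of_nat (a $ k * Poly_Mapping.lookup m k)) * eval_poly (Poly_Mapping.single m c) p"
    by (simp add: sum_distrib_right mult.assoc)
  then show ?case
    by (simp only: d flip: of_nat_sum)
qed (simp_all add: gradient_add distrib_left sum.distrib)

section \<open>Polynomials without a given variable\<close>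

lemma free_of_var_zero [simp]: "free_of_var x 0"
  by (simp add: free_of_var_def)

lemma free_of_var_scalar [simp]: "free_of_var x (scalar c)"
  by (simp add: free_of_var_def)

lemma free_of_var_Var: "x \<noteq> i \<Longrightarrow> free_of_var x (Var i)"
  by (simp add: free_of_var_def Var_def lookup_single)

lemma free_of_var_add: "free_of_var x f \<Longrightarrow> free_of_var x g \<Longrightarrow> free_of_var x (f + g)"
  using keys_add[of f g] by (auto simp: free_of_var_def)

lemma free_of_var_diff: "free_of_var x f \<Longrightarrow> free_of_var x g \<Longrightarrow> free_of_var x (f - g)"
  using keys_diff[of f g] by (auto simp: free_of_var_def)

lemma free_of_var_mult: "free_of_var x f \<Longrightarrow> free_of_var x g \<Longrightarrow> free_of_var x (f * g)"
  using keys_mult[of f g] unfolding free_of_var_def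
  by (smt (verit) add.right_neutral lookup_add mem_Collect_eq subsetD)

lemma free_of_var_power: "free_of_var x f \<Longrightarrow> free_of_var x (f ^ k)"
  using free_of_var_scalar[of x 1] by (induction k) (simp_all add: free_of_var_mult)

lemma free_of_var_prod:
  "finite I \<Longrightarrow> (\<And>i. i \<in> I \<Longrightarrow> free_of_var x (f i)) \<Longrightarrow> free_of_var x (\<Prod>i\<in>I. f i)"
proof (induction rule: finite_induct)
  case empty
  then show ?case
    using free_of_var_scalar[of x 1] by simp
qed (simp add: free_of_var_mult)

lemma free_of_var_subst_poly:
  assumes h: "\<And>i. i \<noteq> x \<Longrightarrow> free_of_var y (h i)" and f: "free_of_var x f"
  shows "free_of_var y (subst_poly h f)"
proof (induction f rule: cpoly_induct_keys)
  case (monomial m c)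
  then have "Poly_Mapping.lookup m x = 0"
    using f by (auto simp: free_of_var_def)
  then have "free_of_var y (h i ^ Poly_Mapping.lookup m i)" for i
    using h[of i] free_of_var_scalar[of y 1] by (cases "i = x") (simp_all add: free_of_var_power)
  then show ?case
    unfolding subst_poly_monomial by (intro free_of_var_mult free_of_var_prod) auto
qed (simp_all add: free_of_var_add)

lemma prod_axis_power_eq_0:
  fixes m :: "'n::finite \<Rightarrow>\<^sub>0 nat"
  assumes "Poly_Mapping.lookup m x = 0" "m \<noteq> 0"
  shows "(\<Prod>i\<in>UNIV. (axis x c $ i :: complex) ^ Poly_Mapping.lookup m i) = 0"
proof -
  obtain i where "Poly_Mapping.lookup m i \<noteq> 0"
    using \<open>m \<noteq> 0\<close> by (metis poly_mapping_eqI lookup_zero)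
  then have "(axis x c $ i :: complex) ^ Poly_Mapping.lookup m i = 0"
    using assms(1) by (auto simp: axis_def)
  then show ?thesis
    by (intro prod_zero) auto
qed

lemma eval_poly_axis_free_of_var:
  assumes "free_of_var x f" "weighted_homogeneous a d f" "0 < d"
  shows "eval_poly f (axis x c) = 0"
proof (induction f rule: cpoly_induct_keys)
  case (monomial m b)
  then have "Poly_Mapping.lookup m x = 0" "m \<noteq> 0"
    using assms by (auto simp: free_of_var_def weighted_homogeneous_def weighted_degree_def)
  then show ?case
    by (simp add: eval_poly_monomial prod_axis_power_eq_0)
qed simp_all

text \<open>At a coordinate point of \<open>x\<close> all other coordinates vanish. So of a polynomial without \<open>x\<close> only
  the linear terms contribute to first derivatives there.\<close>

lemma gradient_axis_free_of_var:
  assumes "free_of_var x f"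
  shows "gradient f (axis x c) $ k = Poly_Mapping.lookup f (Poly_Mapping.single k 1)"
proof (induction f rule: cpoly_induct_keys)
  case (monomial m b)
  let ?e = "Poly_Mapping.single k (1::nat)"
  have x: "Poly_Mapping.lookup m x = 0"
    using monomial assms by (auto simp: free_of_var_def)
  show ?case
  proof (cases "m = ?e \<or> Poly_Mapping.lookup m k = 0")
    case False
    then have "m - ?e \<noteq> 0"
      using single_add_diff_single[of m k] by auto
    moreover have "Poly_Mapping.lookup (m - ?e) x = 0"
      using x by (simp add: lookup_minus)
    ultimately show ?thesis
      using False by (simp add: gradient_monomial prod_axis_power_eq_0 lookup_single)
  qed (auto simp: gradient_monomial lookup_single when_def)
qed (simp_all add: gradient_add lookup_add)

corollary gradient_axis_free_of_var_eq_0: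
  assumes "free_of_var x f" "weighted_homogeneous a d f" "\<And>l. a $ l < d"
  shows "gradient f (axis x c) = 0"
proof -
  have "Poly_Mapping.single k (1::nat) \<notin> Poly_Mapping.keys f" for k
    using assms(2) assms(3)[of k] by (force simp: weighted_homogeneous_def)
  then show ?thesis
    by (simp add: vec_eq_iff gradient_axis_free_of_var[OF assms(1)] in_keys_iff)
qed

section \<open>Coordinate changes and tangent spaces of the cone\<close>

definition jacobian_matrix :: "('n::finite \<Rightarrow> 'n cpoly) \<Rightarrow> complex ^ 'n \<Rightarrow> complex ^ 'n ^ 'n" where
  "jacobian_matrix h p = (\<chi> l. gradient (h l) p)"

lemma gradient_subst_poly:
  "gradient (subst_poly h f) p = gradient f (subst_point h p) v* jacobian_matrix h p"
  by (simp add: chain_rule vec_eq_iff vector_matrix_mult_def jacobian_matrix_def sum_component mult.commute)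

text \<open>The chain rule in matrix form. Applied to a change of variables and its inverse, it shows that the
  Jacobian matrices of the two are inverse to each other.\<close>

lemma jacobian_matrix_compose:
  "jacobian_matrix (\<lambda>i. subst_poly h (k i)) p = jacobian_matrix k (subst_point h p) ** jacobian_matrix h p"
  by (simp add: jacobian_matrix_def vec_eq_iff chain_rule matrix_matrix_mult_def sum_component)

lemma jacobian_matrix_Var: "jacobian_matrix Var p = mat 1"
  by (simp add: jacobian_matrix_def gradient_Var vec_eq_iff mat_def axis_def eq_commute)

lemma jacobian_matrix_axis: "(jacobian_matrix h p *v axis k 1) $ l = gradient (h l) p $ k"
  by (simp add: jacobian_matrix_def matrix_vector_mult_def axis_def if_distrib[where f = "\<lambda>c. _ * c"] cong: if_cong)

lemma sum_vector_matrix_mult: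
  fixes u v :: "complex ^ 'n::finite"
  shows "(\<Sum>i\<in>UNIV. (u v* A) $ i * v $ i) = (\<Sum>i\<in>UNIV. u $ i * (A *v v) $ i)"
  unfolding vector_matrix_mult_def matrix_vector_mult_def
  by (simp add: sum_distrib_left sum_distrib_right mult_ac) (rule sum.swap)

text \<open>The Jacobian matrix of a change of variables identifies the tangent space of the cone in the new
  coordinates with the one in the old coordinates.\<close>

lemma cone_tangent_subst_poly:
  "v \<in> cone_tangent (subst_poly h f) (subst_poly h g) p \<longleftrightarrow>
     jacobian_matrix h p *v v \<in> cone_tangent f g (subst_point h p)"
  by (simp add: cone_tangent_def gradient_subst_poly sum_vector_matrix_mult)

lemma change_of_variables_inverse:
  assumes "change_of_variables a h"
  obtains k where "\<And>i. weighted_homogeneous a (a $ i) (k i)"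
    "\<And>p. subst_point k (subst_point h p) = p" "\<And>p. subst_point h (subst_point k p) = p"
    "\<And>f. subst_poly k (subst_poly h f) = f" "\<And>f. subst_poly h (subst_poly k f) = f"
    "\<And>p. jacobian_matrix k (subst_point h p) ** jacobian_matrix h p = mat 1"
    "\<And>p. jacobian_matrix h p ** jacobian_matrix k (subst_point h p) = mat 1"
proof -
  obtain k where wh: "\<And>i. weighted_homogeneous a (a $ i) (k i)"
    and "\<And>i. subst_poly h (k i) = Var i" "\<And>i. subst_poly k (h i) = Var i"
    using assms by (auto simp: change_of_variables_def)
  then have k: "(\<lambda>i. subst_poly h (k i)) = Var" "(\<lambda>i. subst_poly k (h i)) = Var"
    by auto
  have p: "subst_point k (subst_point h p) = p" "subst_point h (subst_point k p) = p" for p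
    using subst_point_compose[of h k p] subst_point_compose[of k h p]
    by (simp_all add: k subst_point_Var)
  have J: "jacobian_matrix k (subst_point h p) ** jacobian_matrix h p = mat 1" for p
    using jacobian_matrix_compose[of h k p] by (simp add: k jacobian_matrix_Var)
  then have "jacobian_matrix h p ** jacobian_matrix k (subst_point h p) = mat 1" for p
    by (simp add: matrix_left_right_inverse)
  then show thesis
    using wh p J by (intro that[of k]) (auto simp: subst_poly_subst_poly k subst_poly_Var_id)
qed

lemma subst_point_weighted_scale:
  assumes "\<And>i. weighted_homogeneous a (a $ i) (h i)"
  shows "subst_point h (weighted_scale a l p) = weighted_scale a l (subst_point h p)"
  using eval_poly_weighted_scale[OF assms]
  by (simp add: subst_point_def weighted_scale_def vec_eq_iff)

lemma weighted_scale_axis: "weighted_scale a l (axis x c) = l ^ (a $ x) *s axis x c"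
  by (auto simp: weighted_scale_def axis_def vec_eq_iff)

text \<open>A change of variables commutes with the weighted action. Hence at a point fixed by \<open>l\<close> its
  Jacobian matrix commutes with the action of \<open>l\<close> on tangent vectors, and takes the eigenvectors
  \<open>axis k 1\<close> to eigenvectors with the same eigenvalue.\<close>

lemma weighted_scale_jacobian:
  assumes "\<And>i. weighted_homogeneous a (a $ i) (h i)" and "weighted_scale a l p = p"
  shows "weighted_scale a l (jacobian_matrix h p *v axis k 1) = l ^ (a $ k) *s (jacobian_matrix h p *v axis k 1)"
proof -
  have "l ^ (a $ i) * gradient (h i) p $ k = l ^ (a $ k) * gradient (h i) p $ k" for i
    using gradient_weighted_scale[OF assms(1), of i l p k] by (metis assms(2) mult.commute)
  then show ?thesis
    by (simp only: vec_eq_iff jacobian_matrix_axis weighted_scale_def vec_lambda_beta vector_smult_component) simp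
qed

text \<open>Equivariance also matches the tangent directions of orbits. In the new coordinates the orbit of
  the coordinate point lies on the axis of \<open>x\<close>, with tangent vector \<open>a $ x\<close> times \<open>axis x 1\<close>.\<close>

lemma orbit_tangent_subst_point_axis:
  assumes "\<And>i. weighted_homogeneous a (a $ i) (h i)"
  shows "orbit_tangent a (subst_point h (axis x 1)) = jacobian_matrix h (axis x 1) *v (of_nat (a $ x) *s axis x 1)"
proof -
  have "of_nat (a $ l) * eval_poly (h l) (axis x 1) = of_nat (a $ x) * gradient (h l) (axis x 1) $ x" for l
  proof -
    have "of_nat (a $ l) * eval_poly (h l) (axis x 1) =
        (\<Sum>k\<in>UNIV. if k = x then of_nat (a $ k) * gradient (h l) (axis x 1) $ k else 0)"
      unfolding Euler_identity[OF assms, symmetric] by (intro sum.cong) (auto simp: axis_def)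
    then show ?thesis by simp
  qed
  then show ?thesis
    by (simp add: orbit_tangent_def subst_point_def vec_eq_iff vector_scalar_commute jacobian_matrix_axis)
qed

text \<open>The stabilizer can be computed in the new coordinates, where the point is a coordinate point.\<close>

lemma stabilizer_axis:
  assumes cv: "change_of_variables a h" and x: "0 < a $ x"
  shows "stabilizer a (subst_point h (axis x 1)) = {l. l ^ (a $ x) = 1}"
proof -
  have wh: "\<And>i. weighted_homogeneous a (a $ i) (h i)"
    using cv by (simp add: change_of_variables_def)
  have inj: "subst_point h p = subst_point h q \<longleftrightarrow> p = q" for p q
    using change_of_variables_inverse[OF cv] by metis
  have "c *s axis x 1 = axis x 1 \<longleftrightarrow> c = 1" for c :: complex
    by (auto simp: vec_eq_iff axis_def)
  then have "weighted_scale a l (subst_point h (axis x 1)) = subst_point h (axis x 1) \<longleftrightarrow> l ^ (a $ x) = 1" for l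
    by (simp add: subst_point_weighted_scale[OF wh, symmetric] inj weighted_scale_axis)
  then show ?thesis
    using x by (auto simp: stabilizer_def power_0_left)
qed

lemma subst_point_eq_0_iff:
  assumes cv: "change_of_variables a h" and pos: "\<And>i. 0 < a $ i"
  shows "subst_point h p = 0 \<longleftrightarrow> p = 0"
proof -
  have *: "subst_point k 0 = 0" if "\<And>i. weighted_homogeneous a (a $ i) (k i)" for k
  proof -
    have "weighted_scale a 0 0 = 0"
      by (simp add: weighted_scale_def vec_eq_iff)
    then have "eval_poly (k i) 0 = 0" for i
      using eval_poly_weighted_scale[OF that, of i 0 0] pos[of i] by (simp add: power_0_left)
    then show ?thesis
      by (simp add: subst_point_def vec_eq_iff)
  qed
  show ?thesis
    using change_of_variables_inverse[OF cv] * cv by (metis change_of_variables_def)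
qed

lemma vec_independent_axis:
  assumes "distinct [x, k1, k2, k3 :: 'n::finite]" "c \<noteq> 0"
  shows "distinct [c *s axis x 1, axis k1 1, axis k2 1, axis k3 (1::complex)]"
    and "vec.independent {c *s axis x 1, axis k1 1, axis k2 1, axis k3 (1::complex)}"
proof -
  show "distinct [c *s axis x 1, axis k1 1, axis k2 1, axis k3 (1::complex)]"
    using assms by (auto simp: vec_eq_iff axis_def)
  have notin: "u \<notin> vec.span S" if "S \<subseteq> {v. v $ i = 0}" "u $ i \<noteq> 0" for u :: "complex ^ 'n" and S i
  proof -
    have "vec.span S \<subseteq> {v. v $ i = 0}"
      using that(1) by (intro vec.span_minimal) (auto intro!: vec.subspaceI)
    then show ?thesis
      using that(2) by auto
  qed
  have "axis k2 1 \<notin> vec.span {axis k3 (1::complex)}"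
    by (rule notin[of _ k2]) (use assms in \<open>auto simp: axis_def\<close>)
  moreover have "axis k1 1 \<notin> vec.span {axis k2 1, axis k3 (1::complex)}"
    by (rule notin[of _ k1]) (use assms in \<open>auto simp: axis_def\<close>)
  moreover have "c *s axis x 1 \<notin> vec.span {axis k1 1, axis k2 1, axis k3 (1::complex)}"
    by (rule notin[of _ x]) (use assms in \<open>auto simp: axis_def\<close>)
  moreover have "axis k3 (1::complex) \<noteq> 0"
    by (auto simp: vec_eq_iff axis_def)
  ultimately show "vec.independent {c *s axis x 1, axis k1 1, axis k2 1, axis k3 (1::complex)}"
    by (auto simp: vec.independent_insert vec.span_base)
qed

text \<open>The factor \<open>c\<close> will be the weight of \<open>x\<close>, which appears in the orbit tangent vector.\<close>

lemma vec_span_axis: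
  assumes "distinct [x, i, j, k1, k2, k3]" "UNIV = {x, i, j, k1, k2, k3 :: 'n::finite}" "c \<noteq> 0"
  shows "vec.span {c *s axis x 1, axis k1 1, axis k2 1, axis k3 1} = {v :: complex ^ 'n. v $ i = 0 \<and> v $ j = 0}"
    (is "vec.span ?B = ?K")
proof
  show "vec.span ?B \<subseteq> ?K"
    using assms by (intro vec.span_minimal) (auto intro!: vec.subspaceI simp: axis_def)
  show "?K \<subseteq> vec.span ?B"
  proof
    fix v assume "v \<in> ?K"
    then have "v $ l = ((v $ x / c) *s (c *s axis x 1) + v $ k1 *s axis k1 1 + v $ k2 *s axis k2 1 + v $ k3 *s axis k3 1) $ l" for l
      using assms by (cases "l \<in> {x, i, j, k1, k2, k3}") (auto simp: axis_def)
    then have "v = (v $ x / c) *s (c *s axis x 1) + v $ k1 *s axis k1 1 + v $ k2 *s axis k2 1 + v $ k3 *s axis k3 1"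
      unfolding vec_eq_iff by blast
    then show "v \<in> vec.span ?B"
      by (metis (no_types, lifting) vec.span_add vec.span_scale vec.span_base insertCI)
  qed
qed

text \<open>In the new coordinates the gradients of \<open>Var x * Var i + f'\<close> and \<open>Var x * Var j + g'\<close> at the
  coordinate point are \<open>axis i 1\<close> and \<open>axis j 1\<close>: the terms without \<open>x\<close> would have to be linear to
  contribute, but their degrees exceed all weights. So the tangent space of the cone is spanned by
  the four remaining coordinate vectors, which are eigenvectors of the stabilizer. Their images under
  the Jacobian matrix are the basis required at the original point.\<close>

proposition linear_form_local_quotient_type:
  fixes f g :: "'n::finite cpoly"
  assumes cv: "change_of_variables a h"
    and U: "UNIV = {x, i, j, k1, k2, k3}" "distinct [x, i, j, k1, k2, k3]"
    and pos: "\<And>l. 0 < a $ l" and less: "\<And>l. a $ l < d1" "\<And>l. a $ l < d2"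
    and f: "subst_poly h f = Var x * Var i + f'" "weighted_homogeneous a d1 f'" "free_of_var x f'"
    and g: "subst_poly h g = Var x * Var j + g'" "weighted_homogeneous a d2 g'" "free_of_var x g'"
  shows "local_quotient_type a f g (subst_point h (axis x 1)) (a $ x) (a $ k1) (a $ k2) (a $ k3)"
proof -
  let ?e = "axis x 1 :: complex ^ 'n" and ?J = "jacobian_matrix h (axis x 1)"
  let ?p = "subst_point h ?e" and ?c = "of_nat (a $ x) :: complex"
  let ?B = "{?c *s ?e, axis k1 1, axis k2 1, axis k3 1}"
  have wh: "\<And>i. weighted_homogeneous a (a $ i) (h i)"
    using cv by (simp add: change_of_variables_def)
  have c: "?c \<noteq> 0"
    using pos[of x] by simp
  obtain K where K: "K ** ?J = mat 1" "?J ** K = mat 1"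
    using change_of_variables_inverse[OF cv] by metis
  have KJ: "K *v (?J *v v) = v" "?J *v (K *v v) = v" for v
    by (simp_all add: matrix_vector_mul_assoc K)
  then have inj: "inj ((*v) ?J)"
    by (metis injI)
  have ij: "x \<noteq> i" "x \<noteq> j"
    using U by auto
  have "0 < d1" "0 < d2"
    using less pos by fastforce+
  then have "eval_poly (subst_poly h f) ?e = 0" "eval_poly (subst_poly h g) ?e = 0"
    using ij eval_poly_axis_free_of_var[OF f(3,2)] eval_poly_axis_free_of_var[OF g(3,2)]
    by (auto simp: f(1) g(1) axis_def)
  moreover have "?p \<noteq> 0"
    using subst_point_eq_0_iff[OF cv pos] by (auto simp: axis_eq_0_iff)
  ultimately have p: "?p \<in> punctured_cone f g"
    by (simp add: punctured_cone_def eval_subst_poly)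
  have "gradient (subst_poly h f) ?e = axis i 1" "gradient (subst_poly h g) ?e = axis j 1"
    using ij gradient_axis_free_of_var_eq_0[OF f(3,2) less(1)] gradient_axis_free_of_var_eq_0[OF g(3,2) less(2)]
    by (simp_all add: f(1) g(1) gradient_add gradient_mult gradient_Var) (simp_all add: axis_def)
  then have "cone_tangent (subst_poly h f) (subst_poly h g) ?e = {v. v $ i = 0 \<and> v $ j = 0}"
    by (auto simp: cone_tangent_def axis_def if_distrib[where f = "\<lambda>c. c * _"] cong: if_cong)
  then have "vec.span ?B = cone_tangent (subst_poly h f) (subst_poly h g) ?e"
    using vec_span_axis[OF U(2,1) c] by simp
  moreover have "cone_tangent f g ?p = (*v) ?J ` cone_tangent (subst_poly h f) (subst_poly h g) ?e"
  proof
    show "cone_tangent f g ?p \<subseteq> (*v) ?J ` cone_tangent (subst_poly h f) (subst_poly h g) ?e"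
    proof
      fix w assume "w \<in> cone_tangent f g ?p"
      then have "K *v w \<in> cone_tangent (subst_poly h f) (subst_poly h g) ?e"
        by (simp add: cone_tangent_subst_poly KJ)
      then show "w \<in> (*v) ?J ` cone_tangent (subst_poly h f) (subst_poly h g) ?e"
        by (rule rev_image_eqI) (simp add: KJ)
    qed
  qed (auto simp: cone_tangent_subst_poly)
  moreover have "vec.span ((*v) ?J ` ?B) = (*v) ?J ` vec.span ?B"
    by (rule vec.linear_span_image) (rule matrix_vector_mul_linear_gen)
  ultimately have span: "vec.span ((*v) ?J ` ?B) = cone_tangent f g ?p"
    by simp
  have dist: "distinct [x, k1, k2, k3]"
    using U(2) by auto
  have indep: "vec.independent ((*v) ?J ` ?B)"
    using vec_independent_axis(2)[OF dist c] inj
    by (intro vec.linear_independent_injective_image matrix_vector_mul_linear_gen) (auto intro: inj_on_subset)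
  have "distinct (map ((*v) ?J) [?c *s ?e, axis k1 1, axis k2 1, axis k3 1])"
    using vec_independent_axis(1)[OF dist c] inj by (subst distinct_map) (blast intro: inj_on_subset)
  moreover have "orbit_tangent a ?p = ?J *v (?c *s ?e)"
    by (rule orbit_tangent_subst_point_axis[OF wh])
  moreover have "weighted_scale a l (?J *v axis k 1) = l ^ (a $ k) *s (?J *v axis k 1)"
    if "l \<in> stabilizer a ?p" for l k
    using that weighted_scale_jacobian[OF wh, of l ?e k] stabilizer_axis[OF cv pos]
    by (simp add: weighted_scale_axis)
  ultimately have "\<exists>v1 v2 v3. distinct [orbit_tangent a ?p, v1, v2, v3] \<and>
        vec.independent {orbit_tangent a ?p, v1, v2, v3} \<and>
        vec.span {orbit_tangent a ?p, v1, v2, v3} = cone_tangent f g ?p \<and>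
        (\<forall>l\<in>stabilizer a ?p.
           weighted_scale a l v1 = l ^ (a $ k1) *s v1 \<and>
           weighted_scale a l v2 = l ^ (a $ k2) *s v2 \<and>
           weighted_scale a l v3 = l ^ (a $ k3) *s v3)"
    using indep span by (intro exI[of _ "?J *v axis k1 1"] exI[of _ "?J *v axis k2 1"] exI[of _ "?J *v axis k3 1"]) simp
  then show ?thesis
    using p stabilizer_axis[OF cv pos, of x] card_roots_unity_eq[OF pos, of x] finite_roots_unity[of "a $ x"] pos[of x]
    by (simp add: local_quotient_type_def)
qed

section \<open>Terminality and the index\<close>

text \<open>If a number \<open>q > 1\<close> divides \<open>r\<close>, \<open>b1\<close> and \<open>b2\<close>, then the element \<open>k = r / q\<close> of \<open>\<mu>\<^sub>r\<close> acts
  trivially on the first two coordinates, and its age is a single fractional part, hence below 1.\<close>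

lemma terminal_coprime:
  assumes "\<And>k. k \<in> {1..<r} \<Longrightarrow> frac (real (k * b1) / real r) + frac (real (k * b2) / real r)
                        + frac (real (k * b3) / real r) > 1"
    and "2 \<le> r"
  shows "coprime r (gcd b1 b2)"
proof (rule ccontr)
  assume "\<not> coprime r (gcd b1 b2)"
  then obtain q where q: "q dvd r" "q dvd b1" "q dvd b2" "q \<noteq> 1"
    by (metis coprime_iff_gcd_eq_1 gcd_dvd1 gcd_dvd2 dvd_trans)
  then obtain k c1 c2 where r: "r = k * q" and c: "b1 = q * c1" "b2 = q * c2"
    by (metis dvd_def mult.commute)
  then have "real (k * b1) / real r = of_nat c1" "real (k * b2) / real r = of_nat c2"
    using \<open>2 \<le> r\<close> by auto
  then have "frac (real (k * b1) / real r) = 0" "frac (real (k * b2) / real r) = 0"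
    by (simp_all add: frac_def)
  moreover have "frac (real (k * b3) / real r) < 1"
    by (rule frac_lt_1)
  moreover have "k \<in> {1..<r}"
    using \<open>2 \<le> r\<close> \<open>q \<noteq> 1\<close> r by (cases "q = 0"; cases "k = 0") auto
  ultimately show False
    using assms(1)[of k] by linarith
qed

lemma terminal_Fano_cyclic_quotient_singularity:
  assumes "terminal_Fano a d1 d2 f g" and t: "local_quotient_type a f g p r b1 b2 b3" and "2 \<le> r"
  shows "cyclic_quotient_singularity a f g p r b1 b2 b3"
proof -
  have *: "frac (real (k * b1) / real r) + frac (real (k * b2) / real r) + frac (real (k * b3) / real r) > 1"
    if "k \<in> {1..<r}" for k
    using assms that unfolding terminal_Fano_def by blast
  have "coprime r (gcd b1 b2)"
    by (rule terminal_coprime[OF * \<open>2 \<le> r\<close>])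
  moreover have "coprime r (gcd b1 b3)"
    by (rule terminal_coprime[of r b1 b3 b2]) (use * \<open>2 \<le> r\<close> in \<open>simp_all add: algebra_simps\<close>)
  moreover have "coprime r (gcd b2 b3)"
    by (rule terminal_coprime[of r b2 b3 b1]) (use * \<open>2 \<le> r\<close> in \<open>simp_all add: algebra_simps\<close>)
  ultimately show ?thesis
    using t \<open>2 \<le> r\<close> by (simp add: cyclic_quotient_singularity_def)
qed

text \<open>An element of the stabilizer of \<open>q\<close> is a root of unity whose order divides the weight of each
  coordinate that does not vanish at \<open>q\<close>.\<close>

lemma index_le_weight:
  assumes "cyclic_quotient_singularity a f g q s c1 c2 c3" and pos: "\<And>i. 0 < a $ i" and le: "\<And>i. a $ i \<le> M"
  shows "s \<le> M"
proof -
  have q: "q \<in> punctured_cone f g" and s: "card (stabilizer a q) = s"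
    using assms(1) by (auto simp: cyclic_quotient_singularity_def local_quotient_type_def)
  then obtain i where i: "q $ i \<noteq> 0"
    by (auto simp: punctured_cone_def vec_eq_iff)
  have "stabilizer a q \<subseteq> {l. l ^ (a $ i) = 1}"
  proof
    fix l assume "l \<in> stabilizer a q"
    then have "weighted_scale a l q $ i = q $ i"
      by (simp add: stabilizer_def)
    then show "l \<in> {l. l ^ (a $ i) = 1}"
      using i by (simp add: weighted_scale_def)
  qed
  then have "s \<le> card {l::complex. l ^ (a $ i) = 1}"
    unfolding s[symmetric] using pos[of i] by (intro card_mono finite_roots_unity) auto
  then show ?thesis
    using card_roots_unity_eq[OF pos[of i]] le[of i] by linarith
qed

section \<open>Equations linear in one variable\<close>

lemma change_of_variables_compose:
  assumes h: "change_of_variables a h" and k: "change_of_variables a k"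
  shows "change_of_variables a (\<lambda>i. subst_poly h (k i))"
proof -
  obtain h' where h': "\<And>i. weighted_homogeneous a (a $ i) (h' i)"
    "\<And>f. subst_poly h' (subst_poly h f) = f" "\<And>f. subst_poly h (subst_poly h' f) = f"
    using change_of_variables_inverse[OF h] by metis
  obtain k' where k': "\<And>i. weighted_homogeneous a (a $ i) (k' i)"
    "\<And>f. subst_poly k' (subst_poly k f) = f" "\<And>f. subst_poly k (subst_poly k' f) = f"
    using change_of_variables_inverse[OF k] by metis
  have wh: "\<And>i. weighted_homogeneous a (a $ i) (h i)" "\<And>i. weighted_homogeneous a (a $ i) (k i)"
    using h k by (simp_all add: change_of_variables_def)
  have "subst_poly (\<lambda>i. subst_poly h (k i)) (subst_poly k' (h' i)) = Var i" for i
    by (metis h'(3) k'(3) subst_poly_Var subst_poly_subst_poly)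
  moreover have "subst_poly (\<lambda>i. subst_poly k' (h' i)) (subst_poly h (k i)) = Var i" for i
    by (metis h'(2) k'(2) subst_poly_Var subst_poly_subst_poly)
  moreover have "weighted_homogeneous a (a $ i) (subst_poly h (k i))"
    "weighted_homogeneous a (a $ i) (subst_poly k' (h' i))" for i
    by (intro weighted_homogeneous_subst_poly wh h' k')+
  ultimately show ?thesis
    unfolding change_of_variables_def by (intro conjI allI exI[of _ "\<lambda>i. subst_poly k' (h' i)"]) auto
qed

text \<open>The coordinate point of \<open>x\<close> is moved to \<open>p\<close> by adding multiples of \<open>Var x\<close> to the variables. Only
  variables of the same weight as \<open>x\<close> may be changed in this way.\<close>

lemma translation_change_of_variables:
  fixes p :: "complex ^ 'n::finite"
  assumes "p $ x = 1" and "\<And>l. p $ l \<noteq> 0 \<Longrightarrow> a $ l = a $ x"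
  obtains h where "change_of_variables a h" "subst_point h (axis x 1) = p"
proof
  \<comment> \<open>The maps \<open>h c\<close> form a one-parameter group, so \<open>h 1\<close> has the inverse \<open>h (-1)\<close>.\<close>
  define h where "h c l = (if l = x then Var x else Var l + scalar (c * p $ l) * Var x)" for c :: complex and l
  have wh: "weighted_homogeneous a (a $ l) (h c l)" for c l
  proof (cases "p $ l = 0")
    case False
    then have "weighted_homogeneous a (a $ l) (scalar (c * p $ l) * Var x)"
      using weighted_homogeneous_scale[OF weighted_homogeneous_Var, of a x] assms(2) by simp
    then show ?thesis
      by (simp add: h_def weighted_homogeneous_add weighted_homogeneous_Var)
  qed (simp add: h_def weighted_homogeneous_Var)
  have "subst_poly (h c) (h d l) = Var l" if "c + d = 0" for c d l
  proof -
    have "subst_poly (h c) (h d l) = h (c + d) l"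
      by (simp add: h_def distrib_right single_add)
    then show ?thesis
      by (simp add: that h_def)
  qed
  then show "change_of_variables a (h 1)"
    using wh unfolding change_of_variables_def by (intro conjI exI[of _ "h (-1)"]) auto
  show "subst_point (h 1) (axis x 1) = p"
    using assms(1) by (simp add: subst_point_def h_def vec_eq_iff axis_def)
qed

lemma weighted_degree_eq_0_iff:
  assumes "\<And>i. 0 < a $ i"
  shows "weighted_degree a m = 0 \<longleftrightarrow> m = 0"
proof
  assume "weighted_degree a m = 0"
  then have "a $ k * Poly_Mapping.lookup m k = 0" for k
    by (simp add: weighted_degree_def)
  then show "m = 0"
    using assms by (intro poly_mapping_eqI) (metis lookup_zero mult_is_0 less_irrefl)
qed (simp add: weighted_degree_def)

lemma subst_poly_cong:
  assumes "free_of_var i f" and "\<And>l. l \<noteq> i \<Longrightarrow> h l = k l"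
  shows "subst_poly h f = subst_poly k f"
proof (induction f rule: cpoly_induct_keys)
  case (monomial m c)
  then have "Poly_Mapping.lookup m i = 0"
    using assms(1) by (auto simp: free_of_var_def)
  then have "h l ^ Poly_Mapping.lookup m l = k l ^ Poly_Mapping.lookup m l" for l
    using assms(2)[of l] by (cases "l = i") auto
  then show ?case
    by (simp add: subst_poly_monomial)
qed simp_all

text \<open>A polynomial of the degree of \<open>Var i\<close> that contains \<open>Var i\<close> linearly can be taken as a new
  coordinate in place of \<open>Var i\<close>. As all weights are positive, no other monomial of this degree
  contains \<open>Var i\<close>, so the equation \<open>B = scalar c * Var i + B'\<close> can be solved for \<open>Var i\<close>. As \<open>B\<close>
  does not contain \<open>x\<close>, the new coordinates agree with the old ones at the coordinate point of \<open>x\<close>,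
  and polynomials without \<open>x\<close> remain so.\<close>

lemma elementary_change_of_variables:
  fixes B :: "'n::finite cpoly"
  assumes pos: "\<And>l. 0 < a $ l" and wh: "weighted_homogeneous a (a $ i) B"
    and lin: "Poly_Mapping.lookup B (Poly_Mapping.single i 1) \<noteq> 0"
    and x: "free_of_var x B"
  obtains h where "change_of_variables a h" "subst_poly h B = Var i"
    "\<And>l. l \<noteq> i \<Longrightarrow> h l = Var l" "\<And>l. l \<noteq> x \<Longrightarrow> free_of_var x (h l)"
    "subst_point h (axis x 1) = axis x 1"
proof -
  let ?e = "Poly_Mapping.single i (1::nat)"
  define c where "c = Poly_Mapping.lookup B ?e"
  define B' where "B' = B - scalar c * Var i"
  define h where "h l = (if l = i then scalar (1 / c) * (Var i - B') else Var l)" for l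
  define k where "k l = (if l = i then B else Var l)" for l
  have c: "scalar (1 / c) * scalar c = (1 :: 'n cpoly)" "scalar c * scalar (1 / c) = (1 :: 'n cpoly)"
    using lin by (simp_all add: c_def mult_single)
  have "x \<noteq> i"
    using bspec[OF x[unfolded free_of_var_def], of ?e] lin by (auto simp: in_keys_iff)
  have B'_wh: "weighted_homogeneous a (a $ i) B'"
    unfolding B'_def
    by (intro weighted_homogeneous_diff weighted_homogeneous_scale weighted_homogeneous_Var wh)
  have B'_x: "free_of_var x B'"
    unfolding B'_def using x \<open>x \<noteq> i\<close>
    by (intro free_of_var_diff free_of_var_mult free_of_var_Var) simp_all
  have B'_i: "free_of_var i B'"
    unfolding free_of_var_def
  proof (intro ballI, rule ccontr)
    fix m assume m: "m \<in> Poly_Mapping.keys B'" "Poly_Mapping.lookup m i \<noteq> 0"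
    then have "weighted_degree a (?e + (m - ?e)) = a $ i"
      using B'_wh single_add_diff_single[of m i] by (simp add: weighted_homogeneous_def)
    then have "m - ?e = 0"
      by (simp add: weighted_degree_add weighted_degree_eq_0_iff pos)
    then have "m = ?e"
      using single_add_diff_single[of m i] m by simp
    moreover have "Poly_Mapping.lookup B' ?e = 0"
      by (simp add: B'_def c_def lookup_minus Var_def mult_single)
    ultimately show False
      using m by (simp add: in_keys_iff)
  qed
  have B: "B = scalar c * Var i + B'"
    by (simp add: B'_def)
  have B'_subst: "subst_poly h B' = B'" "subst_poly k B' = B'"
    using subst_poly_cong[OF B'_i, of h Var] subst_poly_cong[OF B'_i, of k Var]
    by (simp_all add: h_def k_def subst_poly_Var_id)
  have hB: "subst_poly h B = Var i"
    by (simp add: B B'_subst) (simp add: h_def c flip: mult.assoc)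
  have "subst_poly k (h i) = scalar (1 / c) * (B - B')"
    by (simp add: h_def B'_subst) (simp add: k_def)
  also have "\<dots> = Var i"
    by (simp add: B c flip: mult.assoc)
  finally have kh: "subst_poly k (h i) = Var i" .
  have wh_h: "weighted_homogeneous a (a $ l) (h l)" for l
    using B'_wh by (simp add: h_def weighted_homogeneous_scale weighted_homogeneous_diff weighted_homogeneous_Var)
  moreover have "weighted_homogeneous a (a $ l) (k l)" for l
    using wh by (simp add: k_def weighted_homogeneous_Var)
  moreover have "subst_poly h (k l) = Var l" "subst_poly k (h l) = Var l" for l
    using hB kh by (cases "l = i"; simp add: h_def k_def)+
  ultimately have cv: "change_of_variables a h"
    unfolding change_of_variables_def by blast
  have free: "free_of_var x (h l)" if "l \<noteq> x" for l
    using that B'_x by (auto simp: h_def intro!: free_of_var_mult free_of_var_diff free_of_var_Var)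
  have "eval_poly (h l) (axis x 1) = axis x 1 $ l" for l
  proof (cases "l = x")
    case False
    then show ?thesis
      using eval_poly_axis_free_of_var[OF free wh_h pos] by (simp add: axis_def)
  qed (use \<open>x \<noteq> i\<close> in \<open>simp add: h_def\<close>)
  then have "subst_point h (axis x 1) = axis x 1"
    by (simp add: subst_point_def vec_eq_iff)
  then show thesis
    using cv hB free by (intro that[of h]) (auto simp: h_def)
qed

text \<open>A monomial divisible by the square of \<open>Var x\<close> has degree at least twice the weight of \<open>x\<close>. So
  below this degree there is none, and in this degree the square itself is the only one; its
  coefficient is the value of \<open>f\<close> at the coordinate point.\<close>

lemma linear_in_variable:
  fixes f :: "'n::finite cpoly"
  assumes pos: "\<And>l. 0 < a $ l" and d: "a $ x < d" "d \<le> 2 * a $ x"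
    and wh: "weighted_homogeneous a d f" and root: "eval_poly f (axis x 1) = 0"
  obtains A f' where "f = Var x * A + f'" "free_of_var x A" "weighted_homogeneous a (d - a $ x) A"
    "free_of_var x f'" "weighted_homogeneous a d f'"
proof -
  have "\<exists>A f' c. f = Var x * A + f' + scalar c * Var x ^ 2 \<and>
      free_of_var x A \<and> weighted_homogeneous a (d - a $ x) A \<and> free_of_var x f' \<and> weighted_homogeneous a d f'"
  proof (induction f rule: cpoly_induct_keys)
    case zero
    show ?case
      by (intro exI[of _ 0]) simp
  next
    case (monomial m c)
    let ?e = "Poly_Mapping.single x (1::nat)"
    have m: "weighted_degree a m = d"
      using monomial wh by (simp add: weighted_homogeneous_def)
    consider "Poly_Mapping.lookup m x = 0" | "Poly_Mapping.lookup m x = 1" | "2 \<le> Poly_Mapping.lookup m x"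
      by linarith
    then show ?case
    proof cases
      case 1
      then have "free_of_var x (Poly_Mapping.single m c)" "weighted_homogeneous a d (Poly_Mapping.single m c)"
        using m by (simp_all add: free_of_var_def weighted_homogeneous_monomial)
      then show ?thesis
        by (intro exI[of _ 0] exI[of _ "Poly_Mapping.single m c"]) simp
    next
      case 2
      then have e: "m = ?e + (m - ?e)"
        by (intro single_add_diff_single) simp
      then have "weighted_degree a ?e + weighted_degree a (m - ?e) = d"
        using m by (metis weighted_degree_add)
      then have "weighted_homogeneous a (d - a $ x) (Poly_Mapping.single (m - ?e) c)"
        by (intro weighted_homogeneous_monomial) simp
      moreover have "free_of_var x (Poly_Mapping.single (m - ?e) c)"
        using 2 by (simp add: free_of_var_def lookup_minus)
      moreover have "Poly_Mapping.single m c = Var x * Poly_Mapping.single (m - ?e) c"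
        using e by (simp add: Var_def mult_single)
      ultimately show ?thesis
        by (intro exI[of _ "Poly_Mapping.single (m - ?e) c"] exI[of _ 0]) simp
    next
      case 3
      let ?n = "m - Poly_Mapping.single x 2"
      have e: "m = Poly_Mapping.single x 2 + ?n"
        using 3 by (intro poly_mapping_eqI) (auto simp: lookup_add lookup_minus lookup_single when_def)
      then have "2 * a $ x + weighted_degree a ?n = d"
        using m by (metis weighted_degree_add weighted_degree_single mult.commute)
      then have "?n = 0"
        using d weighted_degree_eq_0_iff[OF pos] by fastforce
      then have "Poly_Mapping.single m c = scalar c * Var x ^ 2"
        using e by (simp add: Var_power mult_single)
      then show ?thesis
        by (intro exI[of _ 0] exI[of _ c]) simp
    qed
  next
    case (add f g)
    then obtain A f' c B g' b where
      "f = Var x * A + f' + scalar c * Var x ^ 2" "free_of_var x A" "weighted_homogeneous a (d - a $ x) A"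
      "free_of_var x f'" "weighted_homogeneous a d f'"
      "g = Var x * B + g' + scalar b * Var x ^ 2" "free_of_var x B" "weighted_homogeneous a (d - a $ x) B"
      "free_of_var x g'" "weighted_homogeneous a d g'"
      by metis
    then show ?case
      by (intro exI[of _ "A + B"] exI[of _ "f' + g'"] exI[of _ "c + b"])
        (simp add: free_of_var_add weighted_homogeneous_add single_add algebra_simps)
  qed
  then obtain A f' c where f: "f = Var x * A + f' + scalar c * Var x ^ 2"
    and A: "free_of_var x A" "weighted_homogeneous a (d - a $ x) A"
    and f': "free_of_var x f'" "weighted_homogeneous a d f'"
    by blast
  have "eval_poly A (axis x 1) = 0" "eval_poly f' (axis x 1) = 0"
    using d by (intro eval_poly_axis_free_of_var[OF A] eval_poly_axis_free_of_var[OF f']; simp)+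
  then have "c = 0"
    using root by (simp add: f power2_eq_square)
  then show thesis
    using that A f' f by simp
qed

lemma gradient_linear_form:
  assumes A: "free_of_var x A" "weighted_homogeneous a e A" "0 < e"
    and f': "free_of_var x f'" "weighted_homogeneous a d f'" "\<And>l. a $ l < d"
  shows "gradient (Var x * A + f') (axis x 1) $ l = Poly_Mapping.lookup A (Poly_Mapping.single l 1)"
  using eval_poly_axis_free_of_var[OF A] gradient_axis_free_of_var_eq_0[OF f'] gradient_axis_free_of_var[OF A(1)]
  by (simp add: gradient_add gradient_mult)

text \<open>With coordinates in which \<open>p\<close> is the coordinate point of \<open>x\<close>, both equations are linear in \<open>Var x\<close>,
  and their gradients at \<open>p\<close> are the linear parts of the coefficients of \<open>Var x\<close>. Quasismoothness
  makes these linear parts independent, in any coordinates. The coefficient in the first equation is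
  made a coordinate \<open>Var i\<close>; the one in the second equation then still contains some \<open>Var j\<close> with
  \<open>j \<noteq> i\<close> linearly, and making it a coordinate does not affect \<open>Var i\<close>.\<close>

proposition linear_normal_form:
  fixes f g :: "'n::finite cpoly"
  assumes pos: "\<And>l. 0 < a $ l" and max: "\<And>l. a $ l \<le> a $ x"
    and d: "a $ x < d1" "d1 \<le> 2 * a $ x" "a $ x < d2" "d2 \<le> 2 * a $ x"
    and wh: "weighted_homogeneous a d1 f" "weighted_homogeneous a d2 g"
    and qs: "quasismooth f g"
    and p: "p $ x = 1" "\<And>l. p $ l \<noteq> 0 \<Longrightarrow> a $ l = a $ x"
    and root: "eval_poly f p = 0" "eval_poly g p = 0"
  obtains h i j f' g' where "change_of_variables a h" "subst_point h (axis x 1) = p" "distinct [x, i, j]"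
    "subst_poly h f = Var x * Var i + f'" "weighted_homogeneous a d1 f'" "free_of_var x f'"
    "subst_poly h g = Var x * Var j + g'" "weighted_homogeneous a d2 g'" "free_of_var x g'"
proof -
  let ?e = "axis x 1 :: complex ^ 'n"
  have less: "a $ l < d1" "a $ l < d2" for l
    using max[of l] d by linarith+
  have pos_d: "0 < d1 - a $ x" "0 < d2 - a $ x"
    using d by simp_all
  have h_wh: "weighted_homogeneous a (a $ i) (h i)" if "change_of_variables a h" for h i
    using that by (simp add: change_of_variables_def)
  have linear: "\<exists>A F'. subst_poly h F = Var x * A + F' \<and> free_of_var x A \<and> weighted_homogeneous a (d - a $ x) A \<and>
      free_of_var x F' \<and> weighted_homogeneous a d F'"
    if "change_of_variables a h" "subst_point h ?e = p" "weighted_homogeneous a d F" "eval_poly F p = 0"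
      "a $ x < d" "d \<le> 2 * a $ x" for h d F
    using linear_in_variable[OF pos that(5,6) weighted_homogeneous_subst_poly[OF h_wh[OF that(1)] that(3)]]
      that(2,4) by (metis eval_subst_poly)
  have independent: "s = 0 \<and> t = 0"
    if cv: "change_of_variables a h" and hp: "subst_point h ?e = p"
      and st: "s *s gradient (subst_poly h f) ?e + t *s gradient (subst_poly h g) ?e = 0" for h s t
  proof -
    obtain k where k: "\<And>f. subst_poly k (subst_poly h f) = f" "\<And>p. subst_point k (subst_point h p) = p"
      using change_of_variables_inverse[OF cv] by metis
    then have "subst_point k p = ?e"
      using hp by metis
    then have "gradient F p = gradient (subst_poly h F) ?e v* jacobian_matrix k p" for F
      using gradient_subst_poly[of k "subst_poly h F" p] by (simp add: k)
    then have "s *s gradient f p + t *s gradient g p =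
        (s *s gradient (subst_poly h f) ?e + t *s gradient (subst_poly h g) ?e) v* jacobian_matrix k p"
      by (simp add: vec_eq_iff vector_matrix_mult_def algebra_simps sum.distrib sum_distrib_left)
    also have "\<dots> = 0"
      unfolding st by (simp add: vec_eq_iff vector_matrix_mult_def)
    finally have "s *s gradient f p + t *s gradient g p = 0" .
    moreover have "p \<in> punctured_cone f g"
      using root p(1) by (auto simp: punctured_cone_def)
    ultimately show ?thesis
      using qs by (auto simp: quasismooth_def)
  qed
  obtain h0 where h0: "change_of_variables a h0" "subst_point h0 ?e = p"
    using translation_change_of_variables[OF p] by metis
  obtain A f0 where A: "subst_poly h0 f = Var x * A + f0" "free_of_var x A" "weighted_homogeneous a (d1 - a $ x) A"
    and f0: "free_of_var x f0" "weighted_homogeneous a d1 f0"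
    using linear[OF h0 wh(1) root(1) d(1,2)] by metis
  have "gradient (subst_poly h0 f) ?e \<noteq> 0"
    using independent[OF h0, of 1 0] by auto
  then obtain i where i: "Poly_Mapping.lookup A (Poly_Mapping.single i 1) \<noteq> 0"
    using gradient_linear_form[OF A(2,3) pos_d(1) f0 less(1)] by (metis A(1) vec_eq_iff zero_index)
  then have ai: "a $ i = d1 - a $ x" and xi: "x \<noteq> i"
    using bspec[OF A(3)[unfolded weighted_homogeneous_def], of "Poly_Mapping.single i 1"]
      bspec[OF A(2)[unfolded free_of_var_def], of "Poly_Mapping.single i 1"] by (auto simp: in_keys_iff)
  obtain h1 where h1: "change_of_variables a h1" "subst_poly h1 A = Var i"
    "\<And>l. l \<noteq> i \<Longrightarrow> h1 l = Var l" "\<And>l. l \<noteq> x \<Longrightarrow> free_of_var x (h1 l)" "subst_point h1 ?e = ?e"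
    using elementary_change_of_variables[OF pos _ i A(2)] A(3) ai by metis
  define h where "h l = subst_poly h1 (h0 l)" for l
  have h: "change_of_variables a h" "subst_point h ?e = p"
    using change_of_variables_compose[OF h1(1) h0(1)] subst_point_compose[of h1 h0 ?e] h1(5) h0(2)
    by (simp_all add: h_def[abs_def])
  define f1 where "f1 = subst_poly h1 f0"
  have f1: "subst_poly h f = Var x * Var i + f1" "free_of_var x f1" "weighted_homogeneous a d1 f1"
    using h1(2) h1(3)[OF xi] free_of_var_subst_poly[OF h1(4) f0(1)]
      weighted_homogeneous_subst_poly[OF h_wh[OF h1(1)] f0(2)]
    by (simp_all add: h_def[abs_def] f1_def A(1) flip: subst_poly_subst_poly)
  obtain B g1 where B: "subst_poly h g = Var x * B + g1" "free_of_var x B" "weighted_homogeneous a (d2 - a $ x) B"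
    and g1: "free_of_var x g1" "weighted_homogeneous a d2 g1"
    using linear[OF h wh(2) root(2) d(3,4)] by metis
  have "\<exists>j. j \<noteq> i \<and> Poly_Mapping.lookup B (Poly_Mapping.single j 1) \<noteq> 0"
  proof (rule ccontr)
    \<comment> \<open>Otherwise the gradient of the second equation is a multiple of that of the first one.\<close>
    let ?b = "Poly_Mapping.lookup B (Poly_Mapping.single i 1)"
    assume *: "\<nexists>j. j \<noteq> i \<and> Poly_Mapping.lookup B (Poly_Mapping.single j 1) \<noteq> 0"
    have "Poly_Mapping.single i (1::nat) = Poly_Mapping.single l 1 \<longleftrightarrow> l = i" for l
      by (metis lookup_single_eq lookup_single_not_eq zero_neq_one)
    then have "gradient (subst_poly h f) ?e $ l = (if l = i then 1 else 0)" for l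
      unfolding f1(1)
      using gradient_linear_form[OF free_of_var_Var[OF xi] weighted_homogeneous_Var pos f1(2,3) less(1)]
      by (simp add: Var_def lookup_single when_def)
    moreover have "gradient (subst_poly h g) ?e $ l = (if l = i then ?b else 0)" for l
      using gradient_linear_form[OF B(2,3) pos_d(2) g1 less(2), of l] * by (auto simp: B(1))
    ultimately have "?b *s gradient (subst_poly h f) ?e + (-1) *s gradient (subst_poly h g) ?e = 0"
      by (simp add: vec_eq_iff)
    then show False
      using independent[OF h, of ?b "-1"] by simp
  qed
  then obtain j where ji: "j \<noteq> i" and j: "Poly_Mapping.lookup B (Poly_Mapping.single j 1) \<noteq> 0"
    by blast
  then have aj: "a $ j = d2 - a $ x" and xj: "x \<noteq> j"
    using bspec[OF B(3)[unfolded weighted_homogeneous_def], of "Poly_Mapping.single j 1"]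
      bspec[OF B(2)[unfolded free_of_var_def], of "Poly_Mapping.single j 1"] by (auto simp: in_keys_iff)
  obtain h2 where h2: "change_of_variables a h2" "subst_poly h2 B = Var j"
    "\<And>l. l \<noteq> j \<Longrightarrow> h2 l = Var l" "\<And>l. l \<noteq> x \<Longrightarrow> free_of_var x (h2 l)" "subst_point h2 ?e = ?e"
    using elementary_change_of_variables[OF pos _ j B(2)] B(3) aj by metis
  define h' where "h' l = subst_poly h2 (h l)" for l
  have h': "change_of_variables a h'" "subst_point h' ?e = p"
    using change_of_variables_compose[OF h2(1) h(1)] subst_point_compose[of h2 h ?e] h2(5) h(2)
    by (simp_all add: h'_def[abs_def])
  have "subst_poly h' f = Var x * Var i + subst_poly h2 f1" "subst_poly h' g = Var x * Var j + subst_poly h2 g1"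
    using h2(2) h2(3)[OF xj] h2(3)[OF ji[symmetric]]
    by (simp_all add: h'_def[abs_def] f1(1) B(1) flip: subst_poly_subst_poly)
  moreover have "free_of_var x (subst_poly h2 f1)" "free_of_var x (subst_poly h2 g1)"
    "weighted_homogeneous a d1 (subst_poly h2 f1)" "weighted_homogeneous a d2 (subst_poly h2 g1)"
    by (intro free_of_var_subst_poly[OF h2(4)] weighted_homogeneous_subst_poly h_wh[OF h2(1)] f1 g1; assumption?)+
  ultimately show thesis
    using xi xj ji by (intro that[OF h', of i j "subst_poly h2 f1" "subst_poly h2 g1"]) auto
qed

section \<open>Points with coordinates of a single weight\<close>

lemma complex_poly_root:
  "degree p \<noteq> 0 \<Longrightarrow> \<exists>z::complex. poly p z = 0"
  by (metis constant_degree fundamental_theorem_of_algebra)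

lemma binary_quadratic_zero:
  fixes A B C :: complex
  obtains x y where "x \<noteq> 0 \<or> y \<noteq> 0" "A * x\<^sup>2 + B * x * y + C * y\<^sup>2 = 0"
proof (cases "C = 0")
  case True
  then show thesis
    by (intro that[of 0 1]) auto
next
  case False
  then obtain y where "poly [:A, B, C:] y = 0"
    using complex_poly_root[of "[:A, B, C:]"] by auto
  then show thesis
    by (intro that[of 1 y]) (auto simp: algebra_simps power2_eq_square)
qed

lemma binary_quartic_zero:
  fixes c0 c1 c2 c3 c4 :: complex
  obtains x y where "x \<noteq> 0 \<or> y \<noteq> 0"
    "c0 * x ^ 4 + c1 * x ^ 3 * y + c2 * x\<^sup>2 * y\<^sup>2 + c3 * x * y ^ 3 + c4 * y ^ 4 = 0"
proof (cases "c4 = 0")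
  case True
  then show thesis
    by (intro that[of 0 1]) auto
next
  case False
  then obtain y where "poly [:c0, c1, c2, c3, c4:] y = 0"
    using complex_poly_root[of "[:c0, c1, c2, c3, c4:]"] by auto
  then show thesis
    by (intro that[of 1 y]) (auto simp: algebra_simps power2_eq_square power3_eq_cube power4_eq_xxxx)
qed

text \<open>The first conic passes through the point \<open>(0 : 0 : 1)\<close>, because it lacks the term \<open>z\<^sup>2\<close>. Write the
  two conics as \<open>q + L z = 0\<close> and \<open>q' + L' z + F z\<^sup>2 = 0\<close>. Eliminating \<open>z = - q / L\<close> leads to a
  binary quartic form, which has a zero \<open>(x, y)\<close>. If \<open>L\<close> vanishes there, then so does \<open>q\<close>, because
  \<open>F \<noteq> 0\<close>. Then the first equation holds for this \<open>(x, y)\<close> and every \<open>z\<close>, and the second one is a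
  quadratic equation for \<open>z\<close>.\<close>

lemma conics_common_zero_aux:
  fixes a b c d e A B C D E F :: complex
  assumes "F \<noteq> 0"
  obtains x y z where "x \<noteq> 0 \<or> y \<noteq> 0"
    "a * x\<^sup>2 + b * x * y + c * y\<^sup>2 + (d * x + e * y) * z = 0"
    "A * x\<^sup>2 + B * x * y + C * y\<^sup>2 + (D * x + E * y) * z + F * z\<^sup>2 = 0"
proof -
  define q where "q x y = a * x\<^sup>2 + b * x * y + c * y\<^sup>2" for x y
  define L where "L x y = d * x + e * y" for x y
  define q' where "q' x y = A * x\<^sup>2 + B * x * y + C * y\<^sup>2" for x y
  define L' where "L' x y = D * x + E * y" for x y
  obtain x y where xy: "x \<noteq> 0 \<or> y \<noteq> 0"
    and res: "F * (q x y)\<^sup>2 - q x y * L x y * L' x y + q' x y * (L x y)\<^sup>2 = 0"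
  proof -
    have "F * (q x y)\<^sup>2 - q x y * L x y * L' x y + q' x y * (L x y)\<^sup>2 =
       (F * a\<^sup>2 - a * d * D + A * d\<^sup>2) * x ^ 4
       + (2 * F * a * b - (a * d * E + a * e * D + b * d * D) + (2 * A * d * e + B * d\<^sup>2)) * x ^ 3 * y
       + (F * (b\<^sup>2 + 2 * a * c) - (a * e * E + b * d * E + b * e * D + c * d * D)
           + (A * e\<^sup>2 + 2 * B * d * e + C * d\<^sup>2)) * x\<^sup>2 * y\<^sup>2
       + (2 * F * b * c - (b * e * E + c * d * E + c * e * D) + (B * e\<^sup>2 + 2 * C * d * e)) * x * y ^ 3
       + (F * c\<^sup>2 - c * e * E + C * e\<^sup>2) * y ^ 4" for x y
      unfolding q_def L_def q'_def L'_def by algebra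
    then show thesis
      using binary_quartic_zero that by metis
  qed
  show thesis
  proof (cases "L x y = 0")
    case False
    let ?z = "- q x y / L x y"
    have "q x y + L x y * ?z = 0"
      using False by simp
    moreover have "q' x y + L' x y * ?z + F * ?z\<^sup>2 =
        (F * (q x y)\<^sup>2 - q x y * L x y * L' x y + q' x y * (L x y)\<^sup>2) / (L x y)\<^sup>2"
      using False by (simp add: field_simps power2_eq_square)
    then have "q' x y + L' x y * ?z + F * ?z\<^sup>2 = 0"
      using res by simp
    ultimately show thesis
      using that xy unfolding q_def L_def q'_def L'_def by blast
  next
    case True
    then have "q x y = 0"
      using res \<open>F \<noteq> 0\<close> by simp
    moreover obtain z where "poly [:q' x y, L' x y, F:] z = 0"
      using complex_poly_root[of "[:q' x y, L' x y, F:]"] \<open>F \<noteq> 0\<close> by auto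
    then have "q' x y + L' x y * z + F * z\<^sup>2 = 0"
      by (simp add: algebra_simps power2_eq_square)
    ultimately show thesis
      using that[of x y z] xy True unfolding q_def L_def q'_def L'_def by auto
  qed
qed

text \<open>Subtracting a multiple of one equation from the other removes the term in \<open>z\<^sup>2\<close> from one of them,
  unless both lack it; in that case \<open>(0 : 0 : 1)\<close> lies on both conics.\<close>

lemma conics_common_zero:
  fixes A B C D E F A' B' C' D' E' F' :: complex
  obtains x y z where "x \<noteq> 0 \<or> y \<noteq> 0 \<or> z \<noteq> 0"
    "A * x\<^sup>2 + B * x * y + C * y\<^sup>2 + (D * x + E * y) * z + F * z\<^sup>2 = 0"
    "A' * x\<^sup>2 + B' * x * y + C' * y\<^sup>2 + (D' * x + E' * y) * z + F' * z\<^sup>2 = 0"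
proof -
  have *: "\<exists>x y z. (x \<noteq> 0 \<or> y \<noteq> 0) \<and> A * x\<^sup>2 + B * x * y + C * y\<^sup>2 + (D * x + E * y) * z + F * z\<^sup>2 = 0 \<and>
      A' * x\<^sup>2 + B' * x * y + C' * y\<^sup>2 + (D' * x + E' * y) * z + F' * z\<^sup>2 = 0"
    if F': "F' \<noteq> 0" for A B C D E F A' B' C' D' E' F' :: complex
  proof -
    let ?r = "F / F'"
    obtain x y z where xy: "x \<noteq> 0 \<or> y \<noteq> 0"
      and 1: "(A - ?r * A') * x\<^sup>2 + (B - ?r * B') * x * y + (C - ?r * C') * y\<^sup>2
          + ((D - ?r * D') * x + (E - ?r * E') * y) * z = 0"
      and 2: "A' * x\<^sup>2 + B' * x * y + C' * y\<^sup>2 + (D' * x + E' * y) * z + F' * z\<^sup>2 = 0"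
      using conics_common_zero_aux[OF F'] by metis
    have F: "F = ?r * F'"
      using F' by simp
    have "A * x\<^sup>2 + B * x * y + C * y\<^sup>2 + (D * x + E * y) * z + ?r * F' * z\<^sup>2 =
        ((A - ?r * A') * x\<^sup>2 + (B - ?r * B') * x * y + (C - ?r * C') * y\<^sup>2
          + ((D - ?r * D') * x + (E - ?r * E') * y) * z)
        + ?r * (A' * x\<^sup>2 + B' * x * y + C' * y\<^sup>2 + (D' * x + E' * y) * z + F' * z\<^sup>2)"
      by (simp only: algebra_simps)
    then have "A * x\<^sup>2 + B * x * y + C * y\<^sup>2 + (D * x + E * y) * z + F * z\<^sup>2 = 0"
      using 1 2 F by simp
    then show ?thesis
      using xy 2 by blast
  qed
  consider "F' \<noteq> 0" | "F \<noteq> 0" | "F = 0" "F' = 0"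
    by blast
  then show thesis
  proof cases
    case 1
    then show ?thesis
      using * that by metis
  next
    case 2
    then show ?thesis
      using *[of F A' B' C' D' E' F' A B C D E] that by metis
  next
    case 3
    then show ?thesis
      by (intro that[of 0 0 1]) simp_all
  qed
qed

lemma eval_monomial_eq_0:
  "Poly_Mapping.lookup m l \<noteq> 0 \<Longrightarrow> p $ l = 0 \<Longrightarrow> eval_poly (Poly_Mapping.single m c) p = 0"
  using prod_zero[of UNIV "\<lambda>i. p $ i ^ Poly_Mapping.lookup m i"] by (auto simp: eval_poly_monomial)

text \<open>The monomials in variables of weight \<open>M\<close> have degrees divisible by \<open>M\<close>.\<close>

lemma eval_poly_weight_space_eq_0:
  assumes wh: "weighted_homogeneous a d f" and "\<not> M dvd d" and p: "\<And>l. p $ l \<noteq> 0 \<Longrightarrow> a $ l = M"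
  shows "eval_poly f p = 0"
proof (induction f rule: cpoly_induct_keys)
  case (monomial m c)
  then have "(\<Sum>l\<in>UNIV. a $ l * Poly_Mapping.lookup m l) = d"
    using wh by (simp add: weighted_homogeneous_def weighted_degree_def)
  then obtain l where "\<not> M dvd a $ l * Poly_Mapping.lookup m l"
    using \<open>\<not> M dvd d\<close> by (metis dvd_sum)
  then have "Poly_Mapping.lookup m l \<noteq> 0" "a $ l \<noteq> M"
    by (metis dvd_0_right mult_0_right, metis dvd_triv_left)
  then show ?case
    using p eval_monomial_eq_0 by metis
qed simp_all

text \<open>The monomials of degree \<open>2 * M\<close> in variables of weight \<open>M\<close> are products of two variables.\<close>

lemma eval_poly_weight_space_quadratic:
  fixes f :: "'n::finite cpoly"
  assumes pos: "\<And>l. 0 < a $ l" and M: "0 < M" and wh: "weighted_homogeneous a (2 * M) f"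
  shows "\<exists>b. \<forall>p. (\<forall>l. p $ l \<noteq> 0 \<longrightarrow> a $ l = M) \<longrightarrow>
      eval_poly f p = (\<Sum>i\<in>UNIV. \<Sum>j\<in>UNIV. b i j * p $ i * p $ j)"
proof (induction f rule: cpoly_induct_keys)
  case zero
  show ?case
    by (intro exI[of _ "\<lambda>i j. 0"]) simp
next
  case (monomial m c)
  then have m: "weighted_degree a m = 2 * M"
    using wh by (simp add: weighted_homogeneous_def)
  show ?case
  proof (cases "\<exists>l. Poly_Mapping.lookup m l \<noteq> 0 \<and> a $ l \<noteq> M")
    case True
    then show ?thesis
      using eval_monomial_eq_0 by (intro exI[of _ "\<lambda>i j. 0"]) fastforce
  next
    case False
    have "m \<noteq> 0"
      using m M by (auto simp: weighted_degree_def)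
    then obtain i where i: "Poly_Mapping.lookup m i \<noteq> 0"
      by (metis poly_mapping_eqI lookup_zero)
    then have ai: "a $ i = M"
      using False by blast
    define n where "n = m - Poly_Mapping.single i 1"
    have mn: "m = Poly_Mapping.single i 1 + n"
      unfolding n_def using i by (rule single_add_diff_single)
    then have n: "weighted_degree a n = M"
      using m ai by (simp add: weighted_degree_add)
    then have "n \<noteq> 0"
      using M by (auto simp: weighted_degree_def)
    then obtain j where j: "Poly_Mapping.lookup n j \<noteq> 0"
      by (metis poly_mapping_eqI lookup_zero)
    then have "Poly_Mapping.lookup m j \<noteq> 0"
      by (simp add: mn lookup_add)
    then have aj: "a $ j = M"
      using False by blast
    have nj: "n = Poly_Mapping.single j 1 + (n - Poly_Mapping.single j 1)"
      using j by (rule single_add_diff_single)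
    then have "weighted_degree a (Poly_Mapping.single j 1) + weighted_degree a (n - Poly_Mapping.single j 1) = M"
      using n by (metis weighted_degree_add)
    then have "n - Poly_Mapping.single j 1 = 0"
      using aj weighted_degree_eq_0_iff[OF pos] by simp
    then have "Poly_Mapping.single m c = scalar c * Var i * Var j"
      using mn nj by (simp add: Var_def mult_single)
    then have "eval_poly (Poly_Mapping.single m c) p =
        (\<Sum>k\<in>UNIV. \<Sum>l\<in>UNIV. (if k = i then if l = j then c else 0 else 0) * p $ k * p $ l)" for p
      by (simp add: if_distrib[where f = "\<lambda>c. c * _"] sum.If_cases cong: if_cong)
    then show ?thesis
      by (intro exI[of _ "\<lambda>k l. if k = i then if l = j then c else 0 else 0"]) blast
  qed
next
  case (add f g)
  then obtain b where
    "\<forall>p. (\<forall>l. p $ l \<noteq> 0 \<longrightarrow> a $ l = M) \<longrightarrow> eval_poly f p = (\<Sum>i\<in>UNIV. \<Sum>j\<in>UNIV. b i j * p $ i * p $ j)"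
    by blast
  moreover from add obtain c where
    "\<forall>p. (\<forall>l. p $ l \<noteq> 0 \<longrightarrow> a $ l = M) \<longrightarrow> eval_poly g p = (\<Sum>i\<in>UNIV. \<Sum>j\<in>UNIV. c i j * p $ i * p $ j)"
    by blast
  ultimately show ?case
    by (intro exI[of _ "\<lambda>i j. b i j + c i j"]) (simp add: distrib_right sum.distrib)
qed

lemma sum_supported:
  fixes p :: "complex ^ 'n::finite"
  assumes "\<And>l. l \<notin> T \<Longrightarrow> p $ l = 0"
  shows "(\<Sum>i\<in>UNIV. \<Sum>j\<in>UNIV. b i j * p $ i * p $ j) = (\<Sum>i\<in>T. \<Sum>j\<in>T. b i j * p $ i * p $ j)"
proof -
  have "(\<Sum>j\<in>UNIV. b i j * p $ i * p $ j) = (\<Sum>j\<in>T. b i j * p $ i * p $ j)" for i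
    using assms by (intro sum.mono_neutral_right) auto
  then show ?thesis
    using assms by (simp, intro sum.mono_neutral_right) auto
qed

lemma weight_space_zero:
  fixes f :: "'n::finite cpoly"
  assumes pos: "\<And>l. 0 < a $ l" and wh: "weighted_homogeneous a (2 * M) f"
    and card: "2 \<le> card {l. a $ l = M}"
  obtains p where "p \<noteq> 0" "\<And>l. p $ l \<noteq> 0 \<Longrightarrow> a $ l = M" "eval_poly f p = 0"
proof -
  obtain T where "T \<subseteq> {l. a $ l = M}" "card T = 2"
    using obtain_subset_with_card_n[OF card] by metis
  then obtain i j where ij: "i \<noteq> j" "a $ i = M" "a $ j = M"
    unfolding card_2_iff by auto
  then have M: "0 < M"
    using pos by metis
  obtain b where b: "\<forall>p. (\<forall>l. p $ l \<noteq> 0 \<longrightarrow> a $ l = M) \<longrightarrow>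
      eval_poly f p = (\<Sum>i\<in>UNIV. \<Sum>j\<in>UNIV. b i j * p $ i * p $ j)"
    using eval_poly_weight_space_quadratic[OF pos M wh] by blast
  obtain x y where xy: "x \<noteq> 0 \<or> y \<noteq> 0" "b i i * x\<^sup>2 + (b i j + b j i) * x * y + b j j * y\<^sup>2 = 0"
    by (rule binary_quadratic_zero)
  define p :: "complex ^ 'n" where "p = (\<chi> l. if l = i then x else if l = j then y else 0)"
  have supp: "a $ l = M" if "p $ l \<noteq> 0" for l
    using that ij by (auto simp: p_def split: if_splits)
  have p0: "p $ l = 0" if "l \<notin> {i, j}" for l
    using that by (simp add: p_def)
  have "eval_poly f p = (\<Sum>k\<in>{i, j}. \<Sum>l\<in>{i, j}. b k l * p $ k * p $ l)"
  proof -
    have "eval_poly f p = (\<Sum>k\<in>UNIV. \<Sum>l\<in>UNIV. b k l * p $ k * p $ l)"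
      using b supp by blast
    also have "\<dots> = (\<Sum>k\<in>{i, j}. \<Sum>l\<in>{i, j}. b k l * p $ k * p $ l)"
      by (rule sum_supported) (rule p0)
    finally show ?thesis .
  qed
  also have "\<dots> = 0"
    using xy(2) ij(1) by (simp add: p_def algebra_simps power2_eq_square)
  finally have "eval_poly f p = 0" .
  moreover have "p \<noteq> 0"
    using xy(1) ij(1) by (auto simp: p_def vec_eq_iff split: if_splits)
  ultimately show thesis
    using that supp by metis
qed

lemma weight_space_common_zero:
  fixes f g :: "'n::finite cpoly"
  assumes pos: "\<And>l. 0 < a $ l"
    and wh: "weighted_homogeneous a (2 * M) f" "weighted_homogeneous a (2 * M) g"
    and card: "3 \<le> card {l. a $ l = M}"
  obtains p where "p \<noteq> 0" "\<And>l. p $ l \<noteq> 0 \<Longrightarrow> a $ l = M" "eval_poly f p = 0" "eval_poly g p = 0"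
proof -
  obtain T where "T \<subseteq> {l. a $ l = M}" "card T = 3"
    using obtain_subset_with_card_n[OF card] by metis
  then obtain i j k where ijk: "i \<noteq> j" "i \<noteq> k" "j \<noteq> k" "a $ i = M" "a $ j = M" "a $ k = M"
    unfolding card_3_iff by auto
  then have M: "0 < M"
    using pos by metis
  obtain b where b: "\<forall>p. (\<forall>l. p $ l \<noteq> 0 \<longrightarrow> a $ l = M) \<longrightarrow>
      eval_poly f p = (\<Sum>i\<in>UNIV. \<Sum>j\<in>UNIV. b i j * p $ i * p $ j)"
    using eval_poly_weight_space_quadratic[OF pos M wh(1)] by blast
  obtain c where c: "\<forall>p. (\<forall>l. p $ l \<noteq> 0 \<longrightarrow> a $ l = M) \<longrightarrow>
      eval_poly g p = (\<Sum>i\<in>UNIV. \<Sum>j\<in>UNIV. c i j * p $ i * p $ j)"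
    using eval_poly_weight_space_quadratic[OF pos M wh(2)] by blast
  obtain x y z where xyz: "x \<noteq> 0 \<or> y \<noteq> 0 \<or> z \<noteq> 0"
    and 1: "b i i * x\<^sup>2 + (b i j + b j i) * x * y + b j j * y\<^sup>2
      + ((b i k + b k i) * x + (b j k + b k j) * y) * z + b k k * z\<^sup>2 = 0"
    and 2: "c i i * x\<^sup>2 + (c i j + c j i) * x * y + c j j * y\<^sup>2
      + ((c i k + c k i) * x + (c j k + c k j) * y) * z + c k k * z\<^sup>2 = 0"
    by (rule conics_common_zero)
  define p :: "complex ^ 'n" where "p = (\<chi> l. if l = i then x else if l = j then y else if l = k then z else 0)"
  have supp: "a $ l = M" if "p $ l \<noteq> 0" for l
    using that ijk by (auto simp: p_def split: if_splits)
  have p0: "p $ l = 0" if "l \<notin> {i, j, k}" for l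
    using that by (simp add: p_def)
  have "eval_poly f p = (\<Sum>r\<in>UNIV. \<Sum>s\<in>UNIV. b r s * p $ r * p $ s)"
    "eval_poly g p = (\<Sum>r\<in>UNIV. \<Sum>s\<in>UNIV. c r s * p $ r * p $ s)"
    using b c supp by blast+
  moreover have "(\<Sum>r\<in>UNIV. \<Sum>s\<in>UNIV. e r s * p $ r * p $ s) =
      (\<Sum>r\<in>{i, j, k}. \<Sum>s\<in>{i, j, k}. e r s * p $ r * p $ s)" for e
    by (rule sum_supported) (rule p0)
  ultimately have "eval_poly f p = (\<Sum>r\<in>{i, j, k}. \<Sum>s\<in>{i, j, k}. b r s * p $ r * p $ s)"
    "eval_poly g p = (\<Sum>r\<in>{i, j, k}. \<Sum>s\<in>{i, j, k}. c r s * p $ r * p $ s)"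
    by metis+
  then have "eval_poly f p = 0" "eval_poly g p = 0"
    using 1 2 ijk by (simp_all add: p_def algebra_simps power2_eq_square)
  moreover have "p \<noteq> 0"
    using xyz ijk by (auto simp: p_def vec_eq_iff split: if_splits)
  ultimately show thesis
    using that supp by metis
qed

text \<open>On the space of the points whose nonzero coordinates all have weight \<open>M\<close>, an equation of degree
  \<open>2 * M\<close> is a quadratic form, and one of any other degree between \<open>M\<close> and \<open>2 * M\<close> vanishes. So the
  assumption on cardinalities says that there are more variables than quadratic forms, and a common
  zero exists. There are at most two forms, so zeros of a binary quadratic form and common zeros of
  two conics are enough. The zero is then normalised with the weighted action.\<close>

proposition point_of_maximal_weight:
  fixes f g :: "'n::finite cpoly"
  assumes pos: "\<And>l. 0 < a $ l"
    and wh: "weighted_homogeneous a d1 f" "weighted_homogeneous a d2 g"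
    and d: "M < d1" "d1 \<le> 2 * M" "M < d2" "d2 \<le> 2 * M"
    and card: "of_bool (d1 = 2 * M) + of_bool (d2 = 2 * M) < card {l. a $ l = M}"
  obtains p x where "p $ x = 1" "\<And>l. p $ l \<noteq> 0 \<Longrightarrow> a $ l = M" "eval_poly f p = 0" "eval_poly g p = 0"
proof -
  have ndvd: "\<not> M dvd d" if "M < d" "d \<le> 2 * M" "d \<noteq> 2 * M" for d
  proof
    assume "M dvd d"
    then obtain k where "d = M * k" ..
    then show False
      using that by (cases k rule: nat.exhaust; cases "k - 1") auto
  qed
  have zero: "eval_poly F p = 0"
    if "weighted_homogeneous a d F" "M < d" "d \<le> 2 * M" "d \<noteq> 2 * M" "\<And>l. p $ l \<noteq> 0 \<Longrightarrow> a $ l = M" for F d p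
    using eval_poly_weight_space_eq_0[OF that(1) ndvd[OF that(2-4)] that(5)] .
  obtain p where p: "p \<noteq> 0" "\<And>l. p $ l \<noteq> 0 \<Longrightarrow> a $ l = M" "eval_poly f p = 0" "eval_poly g p = 0"
  proof (cases "d1 = 2 * M"; cases "d2 = 2 * M")
    assume "d1 = 2 * M" "d2 = 2 * M"
    then show thesis
      using weight_space_common_zero[OF pos, of M f g] wh card that by auto
  next
    assume 1: "d1 = 2 * M" "d2 \<noteq> 2 * M"
    then obtain p where "p \<noteq> 0" "\<And>l. p $ l \<noteq> 0 \<Longrightarrow> a $ l = M" "eval_poly f p = 0"
      using weight_space_zero[OF pos, of M f] wh card by auto
    then show thesis
      using that zero[OF wh(2) d(3,4) 1(2)] by metis
  next
    assume 1: "d1 \<noteq> 2 * M" "d2 = 2 * M"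
    then obtain p where "p \<noteq> 0" "\<And>l. p $ l \<noteq> 0 \<Longrightarrow> a $ l = M" "eval_poly g p = 0"
      using weight_space_zero[OF pos, of M g] wh card by auto
    then show thesis
      using that zero[OF wh(1) d(1,2) 1(1)] by metis
  next
    assume 1: "d1 \<noteq> 2 * M" "d2 \<noteq> 2 * M"
    have "{l. a $ l = M} \<noteq> {}"
      using card by (metis card.empty not_less0)
    then obtain x where "a $ x = M"
      by blast
    then have "axis x (1::complex) $ l \<noteq> 0 \<Longrightarrow> a $ l = M" for l
      by (auto simp: axis_def split: if_splits)
    moreover have "axis x (1::complex) \<noteq> 0"
      by (simp add: axis_eq_0_iff)
    ultimately show thesis
      using that zero[OF wh(1) d(1,2) 1(1)] zero[OF wh(2) d(3,4) 1(2)] by metis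
  qed
  then obtain x where x: "p $ x \<noteq> 0"
    by (auto simp: vec_eq_iff)
  \<comment> \<open>An \<open>M\<close>-th root of the inverse of the coordinate that is to become 1.\<close>
  define l where "l = exp (Ln (1 / p $ x) / of_nat M)"
  have l: "l ^ M = 1 / p $ x"
    using x d unfolding l_def by (simp flip: exp_of_nat_mult)
  let ?q = "weighted_scale a l p"
  have "?q $ x = 1"
    using x l p(2) by (simp add: weighted_scale_def)
  moreover have "a $ k = M" if "?q $ k \<noteq> 0" for k
    using that p(2) by (auto simp: weighted_scale_def)
  moreover have "eval_poly f ?q = 0" "eval_poly g ?q = 0"
    using p(3,4) by (simp_all add: eval_poly_weighted_scale[OF wh(1)] eval_poly_weighted_scale[OF wh(2)])
  ultimately show thesis
    using that by metis
qed

section \<open>The families\<close>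

lemma UNIV_6: "UNIV = {1, 2, 3, 4, 5, 6 :: 6}"
proof -
  have "x \<in> {1, 2, 3, 4, 5, 6}" for x :: 6
  proof (induct x)
    case (of_int z)
    then have "z = 0 \<or> z = 1 \<or> z = 2 \<or> z = 3 \<or> z = 4 \<or> z = 5"
      by fastforce
    then show ?case by auto
  qed
  then show ?thesis by auto
qed

lemma vector_6:
  "(vector [u, v, w, x, y, z] :: ('a::zero) ^ 6) $ 1 = u"
  "(vector [u, v, w, x, y, z] :: ('a::zero) ^ 6) $ 2 = v"
  "(vector [u, v, w, x, y, z] :: ('a::zero) ^ 6) $ 3 = w"
  "(vector [u, v, w, x, y, z] :: ('a::zero) ^ 6) $ 4 = x"
  "(vector [u, v, w, x, y, z] :: ('a::zero) ^ 6) $ 5 = y"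
  "(vector [u, v, w, x, y, z] :: ('a::zero) ^ 6) $ 6 = z"
  unfolding vector_def by simp_all

lemma vector_list_6:
  assumes "length ws = 6"
  shows "(vector ws :: nat ^ 6) $ i \<in> set ws"
    and "card {i. (vector ws :: nat ^ 6) $ i = M} = count_list ws M"
proof -
  obtain u v w x y z where ws: "ws = [u, v, w, x, y, z]"
    using assms by (auto simp: length_Suc_conv numeral_eq_Suc)
  have "i \<in> {1, 2, 3, 4, 5, 6}"
    using UNIV_6 by auto
  then show "(vector ws :: nat ^ 6) $ i \<in> set ws"
    by (auto simp: ws vector_6)
  have "card {i. (vector ws :: nat ^ 6) $ i = M} = (\<Sum>i\<in>UNIV. if (vector ws :: nat ^ 6) $ i = M then 1 else 0)"
    by (simp add: sum.If_cases)
  also have "\<dots> = count_list ws M"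
    unfolding UNIV_6 by (simp add: ws vector_6)
  finally show "card {i. (vector ws :: nat ^ 6) $ i = M} = count_list ws M" .
qed

text \<open>The weights are listed in increasing order, so the last one is the largest.\<close>

lemma Fano_families_weights:
  assumes "(no, d1, d2, ws) \<in> Fano_families"
  shows "length ws = 6 \<and> 2 \<le> last ws \<and> (\<forall>w\<in>set ws. 0 < w \<and> w \<le> last ws) \<and>
    last ws < d1 \<and> d1 \<le> 2 * last ws \<and> last ws < d2 \<and> d2 \<le> 2 * last ws \<and>
    of_bool (d1 = 2 * last ws) + of_bool (d2 = 2 * last ws) < count_list ws (last ws)"
  using assms unfolding Fano_families_def by (elim insertE emptyE; simp)

theorem lemma3p29:
  fixes a :: "nat ^ 6" and f g :: "6 cpoly" and no d1 d2 :: nat and ws :: "nat list"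
  assumes "(no, d1, d2, ws) \<in> Fano_families"
    and "a = vector ws"
    and "complete_intersection a d1 d2 f g"
    and "quasismooth f g"
    and "terminal_Fano a d1 d2 f g"
  shows "(\<exists>p r b1 b2 b3. linear_singularity a d1 d2 f g p r b1 b2 b3) \<and>
         (\<exists>p r b1 b2 b3. linear_singularity a d1 d2 f g p r b1 b2 b3 \<and>
            (\<forall>q s c1 c2 c3. cyclic_quotient_singularity a f g q s c1 c2 c3 \<longrightarrow> s \<le> r))"
proof -
  define M where "M = last ws"
  note weights = Fano_families_weights[OF assms(1), folded M_def]
  have pos: "0 < a $ l" and max: "a $ l \<le> M" for l
    using weights vector_list_6(1)[of ws l] by (auto simp: assms(2))
  have d: "M < d1" "d1 \<le> 2 * M" "M < d2" "d2 \<le> 2 * M"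
    using weights by simp_all
  have card: "of_bool (d1 = 2 * M) + of_bool (d2 = 2 * M) < card {l. a $ l = M}"
    using weights by (simp add: assms(2) vector_list_6(2))
  have wh: "weighted_homogeneous a d1 f" "weighted_homogeneous a d2 g"
    using assms(3) by (simp_all add: complete_intersection_def)
  obtain p x where p: "p $ x = 1" "\<And>l. p $ l \<noteq> 0 \<Longrightarrow> a $ l = M" "eval_poly f p = 0" "eval_poly g p = 0"
    using point_of_maximal_weight[OF pos wh d card] by metis
  have ax: "a $ x = M"
    using p(1,2) by simp
  obtain h i j f' g' where h: "change_of_variables a h" "subst_point h (axis x 1) = p" "distinct [x, i, j]"
    and f: "subst_poly h f = Var x * Var i + f'" "weighted_homogeneous a d1 f'" "free_of_var x f'"
    and g: "subst_poly h g = Var x * Var j + g'" "weighted_homogeneous a d2 g'" "free_of_var x g'"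
    using linear_normal_form[of a x d1 d2 f g p] pos max d wh assms(4) p ax by metis
  have "card (UNIV - {x, i, j}) = 3"
    using h(3) by (simp add: card_Diff_subset)
  then obtain k1 k2 k3 where "UNIV - {x, i, j} = {k1, k2, k3}" "distinct [k1, k2, k3]"
    by (auto simp: card_3_iff)
  then have U: "UNIV = {x, i, j, k1, k2, k3}" "distinct [x, i, j, k1, k2, k3]"
    using h(3) by auto
  have less: "a $ l < d1" "a $ l < d2" for l
    using max[of l] d by linarith+
  have "local_quotient_type a f g p M (a $ k1) (a $ k2) (a $ k3)"
    using linear_form_local_quotient_type[OF h(1) U pos less f g] by (simp add: h(2) ax)
  then have cqs: "cyclic_quotient_singularity a f g p M (a $ k1) (a $ k2) (a $ k3)"
    using terminal_Fano_cyclic_quotient_singularity[OF assms(5)] weights by blast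
  have "linear_singularity a d1 d2 f g p M (a $ k1) (a $ k2) (a $ k3)"
    unfolding linear_singularity_def
  proof (intro conjI exI)
    show "p = (\<chi> l. eval_poly (h l) (axis x 1))"
      using h(2) by (simp add: subst_point_def)
  qed (use cqs h f g in simp_all)
  then show ?thesis
    using index_le_weight[OF _ pos max] by blast
qed

end
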